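(* If $z\in I_n$ then $$\mathcal{ID}(z)=\{E\subseteq L_n:\hat D_{\mathrm{bot}}(z)\le_{\mathcal{ID}}E\}=\{E\subseteq L_n:\hat D_{\mathrm{bot}}(z)\sim_{\mathcal{ID}}E\},$$ where $L_n=\{(j,i)\in[n]\times[n]:i\le j\}$.
   Context: $n$ is a fixed positive integer, $[n]=\{1,\dots,n\}$, $S_n$ is the symmetric group, $I_n=\{w\in S_n:w=w^{-1}\}$. **Involution pipe dreams.** Positions $(i,j)$ are in matrix coordinates. For $D\subseteq\{(i,j)\in[n]\times[n]:i+j\le n\}$ the wiring diagram of $D$ is drawn as follows: in a cell $(i,j)\in D$ one path joins the left edge to the right edge and another joins the bottom edge to the top edge (they cross); in a cell $(i,j)\notin D$ with $i+j\le n$ one path joins left to top and another joins bottom to right (they avoid each other); in a cell with $i+j=n+1$ a single path joins left to top. Connecting these gives $n$ pipes. $D$ is a reduced pipe dream if no two pipes cross more than once; it is a reduced pipe dream for $w\in S_n$ if, labeling left endpoints $1,\dots,n$ from top to bottom and top endpoints $1,\dots,n$ from left to right, the pipe with left endpoint $i$ has top endpoint $w(i)$ for each $i$. $\mathcal{PD}(w)$ is the set of these. A reduced pipe dream $D$ is almost-symmetric if (1) whenever $(i,j)\in D$ with $i<j$, also $(j,i)\in D$; and (2) whenever $(j,i)\in D$ with $i<j$ but $(i,j)\notin D$, the two pipes crossing at $(j,i)$ are also the two pipes that avoid each other at $(i,j)$. $\mathcal{ID}(z)=\{D\cap L_n:D\in\mathcal{PD}(z)\text{ almost-symmetric}\}$.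 **Bottom element.** For $z\in I_n$ let $\hat c_i(z)$ be the number of $j\in[n]$ with $j>i$, $z(i)>z(j)$ and $i\ge z(j)$. $\hat D_{\mathrm{bot}}(z)=\{(i,j)\in[n]\times[n]:j\le\hat c_i(z)\}$. **Ladder moves.** For subsets $D,E\subseteq\mathbb Z_{>0}\times\mathbb Z_{>0}$ write $D\lessdot_{\mathcal{PD}}E$ if for some integers $i<j$ and $k$: $\{i+1,\dots,j-1\}\times\{k,k+1\}\subset D$; $(j,k)\in D$ but $(i,k),(i,k+1),(j,k+1)\notin D$; and $E=D\setminus\{(j,k)\}\cup\{(i,k+1)\}$. Write $D\lessdot_{\mathcal{ID}}E$ if for some integers $i<j$ and $k$: $\{i+1,\dots,j-1\}\times\{k,k+1\}\subset D$; $(i,k),(j,k)\in D$ but $(i,k+1),(i,k+2),(j,k+1)\notin D$; $E=D\setminus\{(j,k)\}\cup\{(i,k+1)\}$; and $D$ contains no positions strictly northeast of and in the same antidiagonal as $(i,k-1)$, $(i,k)$, $(i,k+1)$ or $(i,k+2)$. (An antidiagonal is a set of positions $(p,q)$ with $p+q$ constant. If $j=i+1$ the first condition is vacuous in both definitions.) Let $<_{\mathcal{ID}}$ be the transitive closure of the union of $\lessdot_{\mathcal{PD}}$ and $\lessdot_{\mathcal{ID}}$, let $\le_{\mathcal{ID}}$ be its reflexive version, and let $\sim_{\mathcal{ID}}$ be the symmetric closure of $\le_{\mathcal{ID}}$. *)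

theory Defs
  imports "HOL-Combinatorics.Permutations"
begin

text \<open>Positions are pairs of natural numbers in matrix coordinates, with indices starting at 1;
  index 0 is never used.  An element of \<open>S\<^sub>n\<close> is a function on the naturals permuting \<open>{1..n}\<close>
  and fixing everything else.\<close>

type_synonym pos = "nat \<times> nat"

definition involutions :: "nat \<Rightarrow> (nat \<Rightarrow> nat) set" where
  "involutions n = {w. w permutes {1..n} \<and> w = inv w}"

definition L :: "nat \<Rightarrow> pos set" where
  "L n = {(j, i). (j, i) \<in> {1..n} \<times> {1..n} \<and> i \<le> j}"

definition staircase :: "nat \<Rightarrow> pos set" where
  "staircase n = {(i, j). (i, j) \<in> {1..n} \<times> {1..n} \<and> i + j \<le> n}"


subsection \<open>Wiring diagrams and pipes\<close>

text \<open>\<open>LeftOf i j\<close> and \<open>TopOf i j\<close> are the left and top edges of the cell \<open>(i, j)\<close>.  Hence the right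
  edge of \<open>(i, j)\<close> is \<open>LeftOf i (j + 1)\<close> and its bottom edge is \<open>TopOf (i + 1) j\<close>.\<close>

datatype edge = LeftOf nat nat | TopOf nat nat

text \<open>The paths inside the single cells, each directed from left or bottom to right or top.\<close>

inductive segment :: "nat \<Rightarrow> pos set \<Rightarrow> edge \<Rightarrow> edge \<Rightarrow> bool" for n D where
  cross_horizontal: "(i, j) \<in> staircase n \<Longrightarrow> (i, j) \<in> D \<Longrightarrow>
    segment n D (LeftOf i j) (LeftOf i (j + 1))"
| cross_vertical: "(i, j) \<in> staircase n \<Longrightarrow> (i, j) \<in> D \<Longrightarrow>
    segment n D (TopOf (i + 1) j) (TopOf i j)"
| avoid_upper: "(i, j) \<in> staircase n \<Longrightarrow> (i, j) \<notin> D \<Longrightarrow>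
    segment n D (LeftOf i j) (TopOf i j)"
| avoid_lower: "(i, j) \<in> staircase n \<Longrightarrow> (i, j) \<notin> D \<Longrightarrow>
    segment n D (TopOf (i + 1) j) (LeftOf i (j + 1))"
| boundary: "i \<in> {1..n} \<Longrightarrow> j \<in> {1..n} \<Longrightarrow> i + j = n + 1 \<Longrightarrow>
    segment n D (LeftOf i j) (TopOf i j)"

text \<open>Pipes are identified with the row \<open>p \<in> {1..n}\<close> of their left endpoint.\<close>

definition pipe_through :: "nat \<Rightarrow> pos set \<Rightarrow> nat \<Rightarrow> edge \<Rightarrow> bool" where
  "pipe_through n D p e \<longleftrightarrow> p \<in> {1..n} \<and> (segment n D)\<^sup>*\<^sup>* (LeftOf p 1) e"

text \<open>In a cell of the staircase, one path enters through the left edge and one through the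
  bottom edge.\<close>

definition meet_at :: "nat \<Rightarrow> pos set \<Rightarrow> nat \<Rightarrow> nat \<Rightarrow> pos \<Rightarrow> bool" where
  "meet_at n D p q = (\<lambda>(i, j).
     pipe_through n D p (LeftOf i j) \<and> pipe_through n D q (TopOf (i + 1) j) \<or>
     pipe_through n D q (LeftOf i j) \<and> pipe_through n D p (TopOf (i + 1) j))"

definition cross_at :: "nat \<Rightarrow> pos set \<Rightarrow> nat \<Rightarrow> nat \<Rightarrow> pos \<Rightarrow> bool" where
  "cross_at n D p q c \<longleftrightarrow> c \<in> staircase n \<and> c \<in> D \<and> meet_at n D p q c"

definition avoid_at :: "nat \<Rightarrow> pos set \<Rightarrow> nat \<Rightarrow> nat \<Rightarrow> pos \<Rightarrow> bool" where
  "avoid_at n D p q c \<longleftrightarrow> c \<in> staircase n \<and> c \<notin> D \<and> meet_at n D p q c"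


subsection \<open>Pipe dreams and involution pipe dreams\<close>

definition reduced_pipe_dream :: "nat \<Rightarrow> pos set \<Rightarrow> bool" where
  "reduced_pipe_dream n D \<longleftrightarrow> D \<subseteq> staircase n \<and>
     (\<forall>p\<in>{1..n}. \<forall>q\<in>{1..n}. p \<noteq> q \<longrightarrow>
        (\<forall>c c'. cross_at n D p q c \<and> cross_at n D p q c' \<longrightarrow> c = c'))"

definition PD :: "nat \<Rightarrow> (nat \<Rightarrow> nat) \<Rightarrow> pos set set" where
  "PD n w = {D. reduced_pipe_dream n D \<and> (\<forall>i\<in>{1..n}. pipe_through n D i (TopOf 1 (w i)))}"

definition almost_symmetric :: "nat \<Rightarrow> pos set \<Rightarrow> bool" where
  "almost_symmetric n D \<longleftrightarrow> reduced_pipe_dream n D \<and>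
     (\<forall>i j. i < j \<and> (i, j) \<in> D \<longrightarrow> (j, i) \<in> D) \<and>
     (\<forall>i j. i < j \<and> (j, i) \<in> D \<and> (i, j) \<notin> D \<longrightarrow>
        (\<forall>p q. cross_at n D p q (j, i) \<longleftrightarrow> avoid_at n D p q (i, j)))"

definition ID :: "nat \<Rightarrow> (nat \<Rightarrow> nat) \<Rightarrow> pos set set" where
  "ID n z = {D \<inter> L n | D. D \<in> PD n z \<and> almost_symmetric n D}"


subsection \<open>The bottom element\<close>

definition c_hat :: "nat \<Rightarrow> (nat \<Rightarrow> nat) \<Rightarrow> nat \<Rightarrow> nat" where
  "c_hat n z i = card {j \<in> {1..n}. j > i \<and> z i > z j \<and> i \<ge> z j}"

definition D_hat_bot :: "nat \<Rightarrow> (nat \<Rightarrow> nat) \<Rightarrow> pos set" where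
  "D_hat_bot n z = {(i, j). (i, j) \<in> {1..n} \<times> {1..n} \<and> j \<le> c_hat n z i}"


subsection \<open>Ladder moves\<close>

definition positive_positions :: "pos set" where
  "positive_positions = {1..} \<times> {1..}"

definition ladder_PD :: "pos set \<Rightarrow> pos set \<Rightarrow> bool" where
  "ladder_PD D E \<longleftrightarrow> D \<subseteq> positive_positions \<and> E \<subseteq> positive_positions \<and>
     (\<exists>i j k. i < j \<and>
        {i + 1..<j} \<times> {k, k + 1} \<subseteq> D \<and>
        (j, k) \<in> D \<and> (i, k) \<notin> D \<and> (i, k + 1) \<notin> D \<and> (j, k + 1) \<notin> D \<and>
        E = D - {(j, k)} \<union> {(i, k + 1)})"

definition strictly_northeast_on_antidiagonal :: "pos \<Rightarrow> pos \<Rightarrow> bool" where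
  "strictly_northeast_on_antidiagonal = (\<lambda>(p, q) (i, j). p < i \<and> j < q \<and> p + q = i + j)"

text \<open>The subtraction in \<open>k - 1\<close> does not truncate, as \<open>(i, k) \<in> D\<close> forces \<open>k \<ge> 1\<close>.\<close>

definition ladder_ID :: "pos set \<Rightarrow> pos set \<Rightarrow> bool" where
  "ladder_ID D E \<longleftrightarrow> D \<subseteq> positive_positions \<and> E \<subseteq> positive_positions \<and>
     (\<exists>i j k. i < j \<and>
        {i + 1..<j} \<times> {k, k + 1} \<subseteq> D \<and>
        (i, k) \<in> D \<and> (j, k) \<in> D \<and>
        (i, k + 1) \<notin> D \<and> (i, k + 2) \<notin> D \<and> (j, k + 1) \<notin> D \<and>
        E = D - {(j, k)} \<union> {(i, k + 1)} \<and>
        (\<forall>c\<in>D. \<forall>d\<in>{(i, k - 1), (i, k), (i, k + 1), (i, k + 2)}.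
           \<not> strictly_northeast_on_antidiagonal c d))"

definition less_ID :: "pos set \<Rightarrow> pos set \<Rightarrow> bool" where
  "less_ID = (\<lambda>D E. ladder_PD D E \<or> ladder_ID D E)\<^sup>+\<^sup>+"

definition le_ID :: "pos set \<Rightarrow> pos set \<Rightarrow> bool" where
  "le_ID = less_ID\<^sup>=\<^sup>="

definition sim_ID :: "pos set \<Rightarrow> pos set \<Rightarrow> bool" where
  "sim_ID = symclp le_ID"

end

theory Submission
  imports Defs
begin

text \<open>Reading the lower half of an almost-symmetric pipe dream from the diagonal outwards, each crossing
  either has a mirror image, and then conjugates the involution built so far, or has none, and then
  swaps two adjacent fixed points of that involution.  So the elements of \<open>ID n z\<close> are the subsets
  of the lower staircase whose reading word is an involution word of \<open>z\<close>.

  A ladder move transports a letter through full rows by braid relations, and the second kind of move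
  in addition exchanges the letters \<open>a, a + 1\<close> at a place where the involution read so far fixes \<open>a\<close>,
  \<open>a + 1\<close> and \<open>a + 2\<close>; both preserve involution words, in both directions.  Every move
  increases the sum of the column indices, so it remains to see that a dream from which no inverse
  move starts is the bottom element: it is left-justified, and each row reaches at most two positions
  further than the previous ones, which forces the row lengths one row after the other.\<close>

subsection \<open>Involution words\<close>

text \<open>The letter \<open>i + j - 1\<close> is a line of the wiring diagram. If cells are swept
  so that pipes reach a cell only from cells already passed, a crossing at \<open>(i, j)\<close>
  exchanges the pipes on lines \<open>i + j - 1\<close> and \<open>i + j\<close>, and an avoiding
  cell leaves each pipe on its line. Pipe dreams thus become reduced words. The obstacle is an
  inverse move whose landing place \<open>(j, k)\<close> is occupied. That cell can then be carried
  up through the full rows as in a genuine ladder move, and it collides with row \<open>i\<close> as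
  \<open>a, a\<close> or, over three fixed points, as \<open>a + 1, a, a + 1\<close>. Both make the
  word fail, so in a dream the place is free. The number \<open>c_hat\<close> enters as the number
  of points \<open>p \<le> i\<close> with pending partner that lie below the partner of
  \<open>i\<close>. This count is visible once row \<open>i\<close> has been read and is not changed
  by later rows, so row lengths can be recovered from the final involution. Since
  \<open>sim_ID\<close> is only a symmetric closure, the second equality asks, beyond the first,
  just that no move ends in the bottom element.\<close>

definition adj :: "nat \<Rightarrow> nat \<Rightarrow> nat" where
  "adj k = transpose k (Suc k)"

lemma adj_apply [simp]: "adj k k = Suc k" "adj k (Suc k) = k"
  by (simp_all add: adj_def)

lemma adj_other: "x \<noteq> k \<Longrightarrow> x \<noteq> Suc k \<Longrightarrow> adj k x = x"
  by (simp add: adj_def transpose_def)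

lemma adj_adj [simp]: "adj k (adj k x) = x"
  by (simp add: adj_def)

lemma adj_eq_iff [simp]: "adj k x = adj k y \<longleftrightarrow> x = y"
  by (metis adj_adj)

lemma adj_if: "adj k x = (if x = k then Suc k else if x = Suc k then k else x)"
  by (simp add: adj_def transpose_def)

lemma adj_less_iff:
  "\<not> (x = k \<and> y = Suc k) \<Longrightarrow> \<not> (x = Suc k \<and> y = k) \<Longrightarrow> adj k x < adj k y \<longleftrightarrow> x < y"
  by (auto simp: adj_if)

text \<open>\<open>run ws y\<close> extends the involution \<open>y\<close> by the letters \<open>ws\<close> of an involution word; it is \<open>None\<close> as
  soon as a letter is not an ascent, that is, when the word is not reduced.\<close>

definition iconj :: "nat \<Rightarrow> (nat \<Rightarrow> nat) \<Rightarrow> nat \<Rightarrow> nat" where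
  "iconj k y = (if y k = k \<and> y (Suc k) = Suc k then y \<circ> adj k else adj k \<circ> y \<circ> adj k)"

fun run :: "nat list \<Rightarrow> (nat \<Rightarrow> nat) \<Rightarrow> (nat \<Rightarrow> nat) option" where
  "run [] y = Some y"
| "run (k # ws) y = (if y k < y (Suc k) then run ws (iconj k y) else None)"

definition invol :: "(nat \<Rightarrow> nat) \<Rightarrow> bool" where
  "invol y \<longleftrightarrow> (\<forall>x. y (y x) = x)"

lemma invol_eq_iff: "invol y \<Longrightarrow> y a = b \<longleftrightarrow> y b = a"
  by (auto simp: invol_def)

lemma invol_inj: "invol y \<Longrightarrow> y a = y b \<longleftrightarrow> a = b"
  by (metis invol_def)

lemma invol_iconj: "invol y \<Longrightarrow> invol (iconj k y)"
  unfolding iconj_def invol_def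
  by (auto simp: adj_if) (metis n_not_Suc_n)+

lemma run_append: "run (u @ v) y = Option.bind (run u y) (run v)"
  by (induction u arbitrary: y) auto

lemma invol_run: "run u y = Some y' \<Longrightarrow> invol y \<Longrightarrow> invol y'"
  by (induction u arbitrary: y) (auto simp: invol_iconj split: if_splits)

text \<open>Quantifying over every starting involution, not only \<open>id\<close>, makes this a
  congruence for concatenation. The outcome \<open>None\<close> is compared as well, so reducedness
  is respected.\<close>

definition weq :: "nat list \<Rightarrow> nat list \<Rightarrow> bool" where
  "weq u v \<longleftrightarrow> (\<forall>y. invol y \<longrightarrow> run u y = run v y)"

lemma weq_refl [simp]: "weq u u"
  by (simp add: weq_def)

lemma weq_sym: "weq u v \<Longrightarrow> weq v u"
  by (simp add: weq_def)

lemma weq_trans [trans]: "weq u v \<Longrightarrow> weq v w \<Longrightarrow> weq u w"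
  by (simp add: weq_def)

lemma weq_append:
  assumes "weq u u'" "weq v v'"
  shows "weq (u @ v) (u' @ v')"
  unfolding weq_def run_append
proof (intro allI impI)
  fix y assume y: "invol y"
  show "Option.bind (run u y) (run v) = Option.bind (run u' y) (run v')"
    using assms y invol_run[of u' y] by (cases "run u' y") (auto simp: weq_def)
qed

text \<open>The letters interfere only if \<open>y\<close> matches \<open>{a, Suc a}\<close> with
  \<open>{b, Suc b}\<close>. In that case both orders fail: either each letter turns the other into
  a descent, or both are descents from the start. Otherwise neither letter alters the comparison or
  the fixed points tested by the other.\<close>

lemma weq_commute:
  assumes "Suc a < b"
  shows "weq [a, b] [b, a]"
  unfolding weq_def
proof (intro allI impI)
  fix y assume y: "invol y"
  have inj: "\<And>u v. y u = y v \<longleftrightarrow> u = v" using y by (rule invol_inj)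
  have e: "\<And>u v. y u = v \<Longrightarrow> y v = u" using y by (auto simp: invol_def)
  have ab: "adj a b = b" "adj a (Suc b) = Suc b" "adj b a = a" "adj b (Suc a) = Suc a"
    using assms by (auto simp: adj_if)
  have com: "adj a (adj b x) = adj b (adj a x)" for x
    using assms by (auto simp: adj_if)
  consider (x) "y a = b" "y (Suc a) = Suc b" | (x') "y a = Suc b" "y (Suc a) = b"
    | (n) "\<not> (y b = a \<and> y (Suc b) = Suc a)" "\<not> (y b = Suc a \<and> y (Suc b) = a)"
      "\<not> (y a = b \<and> y (Suc a) = Suc b)" "\<not> (y a = Suc b \<and> y (Suc a) = b)"
    using e by metis
  then show "run [a, b] y = run [b, a] y"
  proof cases
    case x
    then show ?thesis using e[OF x(1)] e[OF x(2)] assms by (auto simp: iconj_def ab)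
  next
    case x'
    then show ?thesis using e[OF x'(1)] e[OF x'(2)] assms by (auto simp: iconj_def ab)
  next
    case n
    have A1: "iconj a y b < iconj a y (Suc b) \<longleftrightarrow> y b < y (Suc b)"
      using n adj_less_iff[of "y b" a "y (Suc b)"] by (auto simp: iconj_def ab)
    have B1: "iconj b y a < iconj b y (Suc a) \<longleftrightarrow> y a < y (Suc a)"
      using n adj_less_iff[of "y a" b "y (Suc a)"] by (auto simp: iconj_def ab)
    have A2: "iconj a y b = b \<longleftrightarrow> y b = b" "iconj a y (Suc b) = Suc b \<longleftrightarrow> y (Suc b) = Suc b"
      using assms by (auto simp: iconj_def ab adj_if)
    have B2: "iconj b y a = a \<longleftrightarrow> y a = a" "iconj b y (Suc a) = Suc a \<longleftrightarrow> y (Suc a) = Suc a"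
      using assms by (auto simp: iconj_def ab adj_if)
    have "iconj b (iconj a y) = iconj a (iconj b y)"
    proof (cases "y a = a \<and> y (Suc a) = Suc a")
      case t1: True
      then have ya: "y a = a" "y (Suc a) = Suc a" by auto
      have ca: "adj a (y v) = y (adj a v)" for v
      proof -
        consider "v = a" | "v = Suc a" | "v \<noteq> a" "v \<noteq> Suc a" by blast
        then show ?thesis
        proof cases
          case 3
          then have "y v \<noteq> a" "y v \<noteq> Suc a" using ya inj by metis+
          then show ?thesis using 3 by (simp add: adj_other)
        qed (use ya in auto)
      qed
      show ?thesis
        using t1 com unfolding iconj_def[of b "iconj a y"] iconj_def[of a "iconj b y"] A2 B2
        by (auto simp: iconj_def fun_eq_iff ca[symmetric])
    next
      case f1: False
      show ?thesis
      proof (cases "y b = b \<and> y (Suc b) = Suc b")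
        case t2: True
        then have yb: "y b = b" "y (Suc b) = Suc b" by auto
        have cb: "adj b (y v) = y (adj b v)" for v
        proof -
          consider "v = b" | "v = Suc b" | "v \<noteq> b" "v \<noteq> Suc b" by blast
          then show ?thesis
          proof cases
            case 3
            then have "y v \<noteq> b" "y v \<noteq> Suc b" using yb inj by metis+
            then show ?thesis using 3 by (simp add: adj_other)
          qed (use yb in auto)
        qed
        show ?thesis
          using t2 f1 com unfolding iconj_def[of b "iconj a y"] iconj_def[of a "iconj b y"] A2 B2
          by (auto simp: iconj_def fun_eq_iff)
      next
        case False
        then show ?thesis
          using f1 com unfolding iconj_def[of b "iconj a y"] iconj_def[of a "iconj b y"] A2 B2
          by (auto simp: iconj_def fun_eq_iff)
      qed
    qed
    then show ?thesis using A1 B1 by auto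
  qed
qed

lemma run_twice: "run [a, a] y = None"
proof -
  consider "y a = a \<and> y (Suc a) = Suc a" | "\<not> (y a = a \<and> y (Suc a) = Suc a)" by blast
  then show ?thesis
  proof cases
    case 1 then show ?thesis by (simp add: iconj_def)
  next
    case 2
    then show ?thesis using adj_less_iff[of "y (Suc a)" a "y a"]
      by (auto simp: iconj_def)
  qed
qed

text \<open>Over three fixed points both words build the transposition of \<open>a\<close> and
  \<open>a + 2\<close>. This half-braid relation is false for general \<open>y\<close>, so it cannot
  be stated as a \<open>weq\<close>.\<close>

lemma run_swap_start:
  assumes "y a = a" "y (Suc a) = Suc a" "y (Suc (Suc a)) = Suc (Suc a)" "invol y"
  shows "run [a, Suc a] y = run [Suc a, a] y"
proof -
  have o: "v \<noteq> a \<Longrightarrow> v \<noteq> Suc a \<Longrightarrow> v \<noteq> Suc (Suc a) \<Longrightarrow>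
      y v \<noteq> a \<and> y v \<noteq> Suc a \<and> y v \<noteq> Suc (Suc a)" for v
    using assms invol_inj[OF assms(4)] by metis
  have "iconj (Suc a) (iconj a y) v = iconj a (iconj (Suc a) y) v" for v
    using o[of v] assms by (auto simp: iconj_def adj_if)
  then have "iconj (Suc a) (iconj a y) = iconj a (iconj (Suc a) y)" by blast
  then show ?thesis using assms by (simp add: iconj_def adj_if)
qed

text \<open>The first two letters create the transposition of \<open>a\<close> and
  \<open>a + 2\<close>, for which \<open>Suc a\<close> is a descent.\<close>

lemma run_braid_start_None:
  assumes "y a = a" "y (Suc a) = Suc a" "y (Suc (Suc a)) = Suc (Suc a)"
  shows "run [Suc a, a, Suc a] y = None"
  using assms by (simp add: iconj_def adj_if)

text \<open>Both words succeed exactly when \<open>y\<close> increases on the three points and does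
  not fix all of them. If no two adjacent points are fixed, every step is a conjugation and the
  braid relation for \<open>adj\<close> applies; the increasing patterns with one adjacent pair of
  fixed points are compared pointwise.\<close>

lemma weq_braid: "weq [a, Suc a, a] [Suc a, a, Suc a]"
  unfolding weq_def
proof (intro allI impI)
  fix y assume y: "invol y"
  have e: "y u = v \<Longrightarrow> y v = u" for u v using y by (auto simp: invol_def)
  define b c where bc: "b = Suc a" "c = Suc b"
  define W where "W = {a, b, c}"
  have ne: "a \<noteq> b" "b \<noteq> a" "a \<noteq> c" "c \<noteq> a" "b \<noteq> c" "c \<noteq> b"
    by (auto simp: bc)
  have A: "adj a a = b" "adj a b = a" "adj a c = c" "adj b a = a" "adj b b = c" "adj b c = b"
    by (auto simp: bc adj_if)
  have out: "adj a v = v" "adj b v = v" if "v \<notin> W" for v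
    using that unfolding W_def bc by (auto simp: adj_if)
  have lt: "a < b" "b < c" "a < c" "\<not> b < a" "\<not> c < b" "\<not> c < a"
    by (auto simp: bc)
  have cmp: "v < b \<longleftrightarrow> v < a" "v < c \<longleftrightarrow> v < a" "a < v \<longleftrightarrow> \<not> v < a" "b < v \<longleftrightarrow> \<not> v < a"
      "c < v \<longleftrightarrow> \<not> v < a" "v \<noteq> a" "v \<noteq> b" "v \<noteq> c" if "v \<notin> W" for v
    using that by (auto simp: W_def bc)
  have br: "adj a (adj b (adj a v)) = adj b (adj a (adj b v))" for v
    by (auto simp: bc adj_if)
  have cl: "y v \<notin> W \<or> y v = a \<or> y v = b \<or> y v = c" for v by (auto simp: W_def)
  have case3: P if "v = a \<Longrightarrow> P" "v = b \<Longrightarrow> P" "v = c \<Longrightarrow> P"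
      "v \<notin> W \<Longrightarrow> y v = a \<Longrightarrow> P" "v \<notin> W \<Longrightarrow> y v = b \<Longrightarrow> P" "v \<notin> W \<Longrightarrow> y v = c \<Longrightarrow> P"
      "v \<notin> W \<Longrightarrow> y v \<notin> W \<Longrightarrow> P" for P v
    using that by (auto simp: W_def)
  note S = A out lt cmp ne iconj_def bc(2)[symmetric] bc(1)[symmetric]
  have fin: "run [a, b, a] y = run [b, a, b] y"
    if "iconj a (iconj b (iconj a y)) = iconj b (iconj a (iconj b y)) \<or> \<not> (y a < y b \<and> y b < y c)"
      "run [a, b, a] y = None \<longleftrightarrow> \<not> (y a < y b \<and> y b < y c) \<or> (y a = a \<and> y b = b \<and> y c = c)"
      "run [b, a, b] y = None \<longleftrightarrow> \<not> (y a < y b \<and> y b < y c) \<or> (y a = a \<and> y b = b \<and> y c = c)"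
    using that by (auto split: if_splits)
  consider "y a \<notin> W" "y b \<notin> W" "y c \<notin> W"
    | "y a = a" "y b \<notin> W" "y c \<notin> W" | "y b = b" "y a \<notin> W" "y c \<notin> W" | "y c = c" "y a \<notin> W" "y b \<notin> W"
    | "y a = a" "y b = b" "y c \<notin> W" | "y a = a" "y c = c" "y b \<notin> W" | "y b = b" "y c = c" "y a \<notin> W"
    | "y a = b" "y b = a" "y c \<notin> W" | "y a = c" "y c = a" "y b \<notin> W" | "y b = c" "y c = b" "y a \<notin> W"
    | "y a = b" "y b = a" "y c = c" | "y a = c" "y c = a" "y b = b" | "y b = c" "y c = b" "y a = a"
    | "y a = a" "y b = b" "y c = c"
    using cl[of a] cl[of b] cl[of c] e ne by metis
  then have "run [a, b, a] y = run [b, a, b] y"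
  proof cases
    case 1
    show ?thesis
      by (rule fin, rule disjI1)
        (use 1 in \<open>simp add: S fun_eq_iff br\<close>, (use 1 in \<open>simp add: S; linarith\<close>)+)
  next
    case 2
    show ?thesis
      by (rule fin, rule disjI1)
        (use 2 in \<open>simp add: S fun_eq_iff br\<close>, (use 2 in \<open>simp add: S; linarith\<close>)+)
  next
    case 3
    show ?thesis
      by (rule fin, rule disjI1)
        (use 3 in \<open>simp add: S fun_eq_iff br\<close>, (use 3 in \<open>simp add: S; linarith\<close>)+)
  next
    case 4
    show ?thesis
      by (rule fin, rule disjI1)
        (use 4 in \<open>simp add: S fun_eq_iff br\<close>, (use 4 in \<open>simp add: S; linarith\<close>)+)
  next
    case 5
    have "iconj a (iconj b (iconj a y)) v = iconj b (iconj a (iconj b y)) v" for v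
      by (rule case3[of v]) (use 5 in \<open>simp_all add: S\<close>)
    then have "iconj a (iconj b (iconj a y)) = iconj b (iconj a (iconj b y))" by blast
    then show ?thesis
      by (intro fin disjI1) (assumption, (use 5 in \<open>simp add: S; linarith\<close>)+)
  next
    case 6
    show ?thesis
      by (use 6 in \<open>simp add: S; linarith\<close>)
  next
    case 7
    have "iconj a (iconj b (iconj a y)) v = iconj b (iconj a (iconj b y)) v" for v
      by (rule case3[of v]) (use 7 in \<open>simp_all add: S\<close>)
    then have "iconj a (iconj b (iconj a y)) = iconj b (iconj a (iconj b y))" by blast
    then show ?thesis
      by (intro fin disjI1) (assumption, (use 7 in \<open>simp add: S; linarith\<close>)+)
  qed (simp_all add: S)
  then show "run [a, Suc a, a] y = run [Suc a, a, Suc a] y" by (simp only: bc)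
qed

subsection \<open>Reading words\<close>

text \<open>A cell precedes everything weakly southwest of it. This is opposite to the direction of
  the pipes, because the word is built from the middle of the symmetric sweep outwards.\<close>

primrec lower_cells :: "nat \<Rightarrow> pos list" where
  "lower_cells 0 = []"
| "lower_cells (Suc n) = lower_cells n @ map (Pair (Suc n)) (rev [1..<Suc (Suc n)])"

fun letter :: "pos \<Rightarrow> nat" where
  "letter (i, j) = i + j - 1"

definition word :: "nat \<Rightarrow> pos set \<Rightarrow> nat list" where
  "word n E = map letter (filter (\<lambda>c. c \<in> E) (lower_cells n))"

definition row_seg :: "pos set \<Rightarrow> nat \<Rightarrow> nat \<Rightarrow> nat \<Rightarrow> nat list" where
  "row_seg E r a b = map (\<lambda>c. r + c - 1) (filter (\<lambda>c. (r, c) \<in> E) (rev [a..<b]))"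

definition rows :: "pos set \<Rightarrow> nat \<Rightarrow> nat \<Rightarrow> nat list" where
  "rows E i j = concat (map (\<lambda>r. row_seg E r 1 (Suc r)) [i..<j])"

lemma rows_append: "i \<le> j \<Longrightarrow> j \<le> k \<Longrightarrow> rows E i k = rows E i j @ rows E j k"
proof -
  assume "i \<le> j" "j \<le> k"
  then have "[i..<k] = [i..<j] @ [j..<k]" using upt_add_eq_append[of i j "k - j"] by simp
  then show ?thesis by (simp add: rows_def)
qed

lemma rows_Suc: "i \<le> j \<Longrightarrow> rows E i (Suc j) = rows E i j @ row_seg E j 1 (Suc j)"
  by (simp add: rows_def)

lemma rows_Cons: "i < j \<Longrightarrow> rows E i j = row_seg E i 1 (Suc i) @ rows E (Suc i) j"
  by (simp add: rows_def upt_conv_Cons)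

lemma rows_cong: "(\<And>r c. i \<le> r \<Longrightarrow> r < j \<Longrightarrow> (r, c) \<in> E \<longleftrightarrow> (r, c) \<in> E') \<Longrightarrow> rows E i j = rows E' i j"
  unfolding rows_def row_seg_def
  by (intro arg_cong[of _ _ concat] map_cong filter_cong refl) auto

lemma word_Suc: "word (Suc n) E = word n E @ row_seg E (Suc n) 1 (Suc (Suc n))"
proof -
  have "map letter (filter (\<lambda>c. c \<in> E) (map (Pair (Suc n)) xs))
      = map (\<lambda>c. Suc n + c - 1) (filter (\<lambda>c. (Suc n, c) \<in> E) xs)" for xs
    by (induction xs) auto
  then show ?thesis unfolding word_def row_seg_def lower_cells.simps filter_append map_append
    by metis
qed

lemma word_rows: "word n E = rows E 1 (Suc n)"
proof (induction n)
  case 0 then show ?case by (simp add: word_def rows_def)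
next
  case (Suc n) then show ?case by (simp add: word_Suc rows_Suc)
qed

lemma set_row_seg: "set (row_seg E r a b) = {r + c - 1 |c. a \<le> c \<and> c < b \<and> (r, c) \<in> E}"
  by (auto simp: row_seg_def)

lemma row_seg_cong: "(\<And>c. a \<le> c \<Longrightarrow> c < b \<Longrightarrow> (r, c) \<in> E \<longleftrightarrow> (r, c) \<in> E') \<Longrightarrow>
    row_seg E r a b = row_seg E' r a b"
  unfolding row_seg_def by (intro map_cong filter_cong refl) auto

lemma row_seg_append: "a \<le> b \<Longrightarrow> b \<le> c \<Longrightarrow> row_seg E r a c = row_seg E r b c @ row_seg E r a b"
  using upt_add_eq_append[of a b "c - b"] by (simp add: row_seg_def)

text \<open>A ladder move rearranges only two adjacent columns; this isolates their letters in
  reading order.\<close>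

definition col_pair :: "pos set \<Rightarrow> nat \<Rightarrow> nat \<Rightarrow> nat list" where
  "col_pair E r k = (if (r, k + 1) \<in> E then [r + k] else []) @ (if (r, k) \<in> E then [r + k - 1] else [])"

lemma row_split:
  assumes "1 \<le> k" "k < r"
  shows "row_seg E r 1 (Suc r) = row_seg E r (k + 2) (Suc r) @ col_pair E r k @ row_seg E r 1 k"
proof -
  have "row_seg E r k (k + 2) = col_pair E r k"
    by (auto simp: row_seg_def col_pair_def upt_conv_Cons)
  then show ?thesis
    using row_seg_append[of 1 k "Suc r" E r] row_seg_append[of k "k+2" "Suc r" E r] assms by simp
qed

lemma weq_commute_list:
  "(\<And>x. x \<in> set u \<Longrightarrow> Suc x < a \<or> Suc a < x) \<Longrightarrow> weq (u @ [a]) ([a] @ u)"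
proof (induction u)
  case (Cons x u)
  have "weq ([x] @ (u @ [a])) ([x] @ ([a] @ u))"
    by (intro weq_append weq_refl Cons.IH) (use Cons.prems in auto)
  moreover have "weq [x, a] [a, x]"
    using Cons.prems[of x] weq_commute[of x a] weq_sym[OF weq_commute[of a x]] by auto
  then have "weq ([x, a] @ u) ([a, x] @ u)" by (rule weq_append) simp
  ultimately show ?case using weq_trans by fastforce
qed simp

text \<open>The core of a ladder move: a letter travels upwards through full rows by braid relations.\<close>

lemma weq_braid_rows:
  assumes "1 \<le> k" "k < i" "Suc i \<le> j"
    and "\<And>r. i < r \<Longrightarrow> r < j \<Longrightarrow> (r, k) \<in> E \<and> (r, k + 1) \<in> E"
  shows "weq (rows E (Suc i) j @ [j + k - 1]) ([i + k] @ rows E (Suc i) j)"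
  using assms(3,4)
proof (induction j rule: dec_induct)
  case base
  then show ?case by (simp add: rows_def)
next
  case (step j)
  let ?H = "row_seg E j (k + 2) (Suc j)" and ?L = "row_seg E j 1 k"
  let ?a = "j + k - 1"
  have a: "Suc ?a = j + k" using assms(1) by simp
  \<comment> \<open>The incoming letter \<open>Suc ?a\<close> meets the full pair and leaves it on
    the other side as \<open>?a\<close>. It drops by one per row, so on reaching row
    \<open>i\<close> it is the letter of column \<open>k + 1\<close>.\<close>
  have m: "col_pair E j k = [Suc ?a, ?a]" using step.prems[of j] step.hyps a by (simp add: col_pair_def)
  have "weq (?L @ [Suc ?a]) ([Suc ?a] @ ?L)"
    using assms(1) by (intro weq_commute_list) (auto simp: set_row_seg)
  then have "weq ((?H @ [Suc ?a, ?a]) @ (?L @ [Suc ?a])) ((?H @ [Suc ?a, ?a]) @ ([Suc ?a] @ ?L))"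
    by (rule weq_append[OF weq_refl])
  also have "weq ((?H @ [Suc ?a, ?a]) @ ([Suc ?a] @ ?L)) (?H @ [?a, Suc ?a, ?a] @ ?L)"
    using weq_append[OF weq_refl[of ?H] weq_append[OF weq_sym[OF weq_braid[of ?a]] weq_refl[of ?L]]]
    by simp
  also have "weq (?H @ [?a]) ([?a] @ ?H)"
    using assms(1) by (intro weq_commute_list) (auto simp: set_row_seg)
  then have "weq ((?H @ [?a]) @ ([Suc ?a, ?a] @ ?L)) (([?a] @ ?H) @ ([Suc ?a, ?a] @ ?L))"
    by (rule weq_append[OF _ weq_refl])
  then have "weq (?H @ [?a, Suc ?a, ?a] @ ?L) ([?a] @ ?H @ [Suc ?a, ?a] @ ?L)"
    by simp
  finally have w: "weq (row_seg E j 1 (Suc j) @ [Suc ?a]) ([?a] @ row_seg E j 1 (Suc j))"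
    using row_split[of k j E] assms step.hyps m by simp
  have "weq (rows E (Suc i) j @ (row_seg E j 1 (Suc j) @ [Suc ?a]))
      (rows E (Suc i) j @ ([?a] @ row_seg E j 1 (Suc j)))"
    by (intro weq_append weq_refl w)
  also have "weq ((rows E (Suc i) j @ [?a]) @ row_seg E j 1 (Suc j))
     (([i + k] @ rows E (Suc i) j) @ row_seg E j 1 (Suc j))"
    by (intro weq_append weq_refl step.IH) (use step.prems in auto)
  then have "weq (rows E (Suc i) j @ ([?a] @ row_seg E j 1 (Suc j)))
     (([i + k] @ rows E (Suc i) j) @ row_seg E j 1 (Suc j))" by simp
  finally show ?case using step.hyps a by (simp add: rows_Suc)
qed

text \<open>The normal form keeps row \<open>i\<close> arbitrary in order to serve twice: with
  \<open>(i, k + 1)\<close> free it leads to the word of the ladder target, with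
  \<open>(i, k + 1)\<close> occupied it exposes a factor on which \<open>run\<close> fails.\<close>

lemma weq_word_bubble:
  assumes k: "1 \<le> k" "k < i" and j: "i < j" "j \<le> n"
    and m: "\<And>r. i < r \<Longrightarrow> r < j \<Longrightarrow> (r, k) \<in> E \<and> (r, k + 1) \<in> E"
    and E: "(j, k) \<in> E" "(j, k + 1) \<notin> E"
  shows "weq (word n E) (rows E 1 i @ row_seg E i (k + 2) (Suc i) @ col_pair E i k @ [i + k] @
           row_seg E i 1 k @ rows (E - {(j, k)}) (Suc i) (Suc n))"
proof -
  let ?H = "row_seg E j (k + 2) (Suc j)" and ?L = "row_seg E j 1 k" and ?t = "j + k - 1"
  let ?A = "rows E 1 i @ row_seg E i (k + 2) (Suc i) @ col_pair E i k" and ?Li = "row_seg E i 1 k"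
  let ?M = "rows E (Suc i) j" and ?Z = "rows E (Suc j) (Suc n)"
  have "rows E 1 (Suc n) = rows E 1 i @ rows E i (Suc n)"
    using k j by (intro rows_append) auto
  also have "rows E i (Suc n) = row_seg E i 1 (Suc i) @ rows E (Suc i) (Suc n)"
    using j by (intro rows_Cons) auto
  also have "rows E (Suc i) (Suc n) = ?M @ rows E j (Suc n)"
    using j by (intro rows_append) auto
  also have "rows E j (Suc n) = row_seg E j 1 (Suc j) @ ?Z"
    using j by (intro rows_Cons) auto
  finally have 1: "word n E = (?A @ ?Li @ ?M) @ (?H @ [?t]) @ ?L @ ?Z"
    using row_split[of k i E] row_split[of k j E] k j E by (simp add: word_rows col_pair_def)
  have "rows (E - {(j, k)}) (Suc i) (Suc n) = rows (E - {(j, k)}) (Suc i) j @ rows (E - {(j, k)}) j (Suc n)"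
    using j by (intro rows_append) auto
  also have "rows (E - {(j, k)}) j (Suc n) = row_seg (E - {(j, k)}) j 1 (Suc j) @ rows (E - {(j, k)}) (Suc j) (Suc n)"
    using j by (intro rows_Cons) auto
  also have "row_seg (E - {(j, k)}) j 1 (Suc j) = row_seg (E - {(j, k)}) j (k + 2) (Suc j) @ row_seg (E - {(j, k)}) j 1 k"
    using row_split[of k j "E - {(j, k)}"] k j E by (simp add: col_pair_def)
  also have "row_seg (E - {(j, k)}) j (k + 2) (Suc j) = ?H" by (rule row_seg_cong) auto
  also have "row_seg (E - {(j, k)}) j 1 k = ?L" by (rule row_seg_cong) auto
  also have "rows (E - {(j, k)}) (Suc i) j = ?M" by (rule rows_cong) auto
  also have "rows (E - {(j, k)}) (Suc j) (Suc n) = ?Z" by (rule rows_cong) auto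
  finally have 2: "rows (E - {(j, k)}) (Suc i) (Suc n) = ?M @ ?H @ ?L @ ?Z" by simp
  have "weq (?H @ [?t]) ([?t] @ ?H)"
    using k by (intro weq_commute_list) (auto simp: set_row_seg)
  then have "weq (word n E) ((?A @ ?Li @ ?M) @ ([?t] @ ?H) @ ?L @ ?Z)"
    unfolding 1 by (rule weq_append[OF weq_refl weq_append[OF _ weq_refl]])
  also have "(?A @ ?Li @ ?M) @ ([?t] @ ?H) @ ?L @ ?Z = (?A @ ?Li) @ (?M @ [?t]) @ ?H @ ?L @ ?Z" by simp
  also have "weq ((?A @ ?Li) @ (?M @ [?t]) @ ?H @ ?L @ ?Z) ((?A @ ?Li) @ ([i + k] @ ?M) @ ?H @ ?L @ ?Z)"
    by (intro weq_append weq_refl weq_braid_rows k m) (use j in auto)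
  also have "(?A @ ?Li) @ ([i + k] @ ?M) @ ?H @ ?L @ ?Z = ?A @ (?Li @ [i + k]) @ ?M @ ?H @ ?L @ ?Z" by simp
  also have "weq (?A @ (?Li @ [i + k]) @ ?M @ ?H @ ?L @ ?Z) (?A @ ([i + k] @ ?Li) @ ?M @ ?H @ ?L @ ?Z)"
    using k by (intro weq_append weq_refl weq_commute_list) (auto simp: set_row_seg)
  finally show ?thesis unfolding 2 by simp
qed

lemma word_ladder_target:
  assumes k: "1 \<le> k" "k < i" and j: "i < j" "j \<le> n"
    and E': "E' = E - {(j, k)} \<union> {(i, k + 1)}"
  shows "word n E' = rows E 1 i @ row_seg E i (k + 2) (Suc i) @ col_pair E' i k @
           row_seg E i 1 k @ rows (E - {(j, k)}) (Suc i) (Suc n)"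
proof -
  have "rows E' 1 (Suc n) = rows E' 1 i @ rows E' i (Suc n)"
    using k j by (intro rows_append) auto
  also have "rows E' i (Suc n) = row_seg E' i 1 (Suc i) @ rows E' (Suc i) (Suc n)"
    using j by (intro rows_Cons) auto
  also have "row_seg E' i 1 (Suc i) = row_seg E' i (k + 2) (Suc i) @ col_pair E' i k @ row_seg E' i 1 k"
    using row_split k by blast
  also have "row_seg E' i (k + 2) (Suc i) = row_seg E i (k + 2) (Suc i)"
    by (rule row_seg_cong) (use j in \<open>auto simp: E'\<close>)
  also have "row_seg E' i 1 k = row_seg E i 1 k"
    by (rule row_seg_cong) (use j in \<open>auto simp: E'\<close>)
  also have "rows E' 1 i = rows E 1 i" by (rule rows_cong) (use j in \<open>auto simp: E'\<close>)
  also have "rows E' (Suc i) (Suc n) = rows (E - {(j, k)}) (Suc i) (Suc n)"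
    by (rule rows_cong) (use j in \<open>auto simp: E'\<close>)
  finally show ?thesis by (simp add: word_rows)
qed

lemma run_fix:
  "run ws y = Some y' \<Longrightarrow> y x = x \<Longrightarrow> x \<notin> set ws \<Longrightarrow> (\<And>w. w \<in> set ws \<Longrightarrow> x \<noteq> Suc w) \<Longrightarrow> y' x = x"
proof (induction ws arbitrary: y)
  case (Cons w ws)
  have "iconj w y x = x" using Cons.prems by (auto simp: iconj_def adj_if)
  then show ?case using Cons by (auto split: if_splits)
qed simp

lemma set_rows: "set (rows E i j) = {r + c - 1 |r c. i \<le> r \<and> r < j \<and> 1 \<le> c \<and> c \<le> r \<and> (r, c) \<in> E}"
  by (fastforce simp: rows_def set_row_seg)

subsection \<open>Ladder moves\<close>

text \<open>The word model of \<open>ID n z\<close>; the two are identified in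
  \<open>ID_eq_inv_dreams\<close>.\<close>

definition inv_dreams :: "nat \<Rightarrow> (nat \<Rightarrow> nat) \<Rightarrow> pos set set" where
  "inv_dreams n z = {E. E \<subseteq> L n \<inter> staircase n \<and> run (word n E) id = Some z}"

definition ladder :: "pos set \<Rightarrow> pos set \<Rightarrow> bool" where
  "ladder D E \<longleftrightarrow> ladder_PD D E \<or> ladder_ID D E"

lemma invol_id: "invol id"
  by (simp add: invol_def)

text \<open>Needed because the half-braid relation holds only at the involution that the prefix
  actually reaches.\<close>

lemma run_cong_middle:
  "(\<And>y. run u id = Some y \<Longrightarrow> run v y = run w y) \<Longrightarrow> run (u @ v @ x) id = run (u @ w @ x) id"
  by (cases "run u id") (auto simp: run_append)

lemma run_middle_None:
  "(\<And>y. run u id = Some y \<Longrightarrow> run v y = None) \<Longrightarrow> run (u @ v @ x) id = None"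
  by (cases "run u id") (auto simp: run_append)

text \<open>A common form of both moves, which differ in whether \<open>(i, k)\<close> is occupied.
  The northeast condition becomes one on coordinate sums, since a cell in an earlier row of the same
  antidiagonal is automatically further right.\<close>

lemma ladder_rectangle:
  assumes "ladder D E"
  shows "\<exists>i j k. 1 \<le> i \<and> 1 \<le> k \<and> i < j \<and>
    (\<forall>r. i < r \<longrightarrow> r < j \<longrightarrow> (r, k) \<in> D \<and> (r, k + 1) \<in> D) \<and>
    (j, k) \<in> D \<and> (i, k + 1) \<notin> D \<and> (j, k + 1) \<notin> D \<and> E = D - {(j, k)} \<union> {(i, k + 1)} \<and>
    ((i, k) \<notin> D \<or> (i, k) \<in> D \<and> (i, k + 2) \<notin> D \<and>
      (\<forall>p q. (p, q) \<in> D \<longrightarrow> p < i \<longrightarrow> p + q \<notin> {i + k - 1, i + k, i + k + 1, i + k + 2}))"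
proof -
  let ?NE = "\<lambda>i k. \<forall>c\<in>D. \<forall>d\<in>{(i, k - 1), (i, k), (i, k + 1), (i, k + 2)}.
           \<not> strictly_northeast_on_antidiagonal c d"
  have pos: "D \<subseteq> positive_positions" "E \<subseteq> positive_positions"
    using assms by (auto simp only: ladder_def ladder_PD_def ladder_ID_def)
  have "\<exists>i j k. i < j \<and> {i + 1..<j} \<times> {k, k + 1} \<subseteq> D \<and>
    (j, k) \<in> D \<and> (i, k + 1) \<notin> D \<and> (j, k + 1) \<notin> D \<and> E = D - {(j, k)} \<union> {(i, k + 1)} \<and>
    ((i, k) \<notin> D \<or> (i, k) \<in> D \<and> (i, k + 2) \<notin> D \<and> ?NE i k)"
    using assms unfolding ladder_def
  proof
    assume "ladder_PD D E"
    then obtain i j k where h: "i < j" "{i + 1..<j} \<times> {k, k + 1} \<subseteq> D" "(j, k) \<in> D"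
      "(i, k + 1) \<notin> D" "(j, k + 1) \<notin> D" "E = D - {(j, k)} \<union> {(i, k + 1)}" "(i, k) \<notin> D"
      unfolding ladder_PD_def by (elim exE conjE) (rule that; assumption)
    show ?thesis
      by (intro exI[of _ i] exI[of _ j] exI[of _ k] conjI disjI1) (rule h)+
  next
    assume "ladder_ID D E"
    then obtain i j k where h: "i < j" "{i + 1..<j} \<times> {k, k + 1} \<subseteq> D" "(j, k) \<in> D"
      "(i, k + 1) \<notin> D" "(j, k + 1) \<notin> D" "E = D - {(j, k)} \<union> {(i, k + 1)}" "(i, k) \<in> D"
      "(i, k + 2) \<notin> D" "?NE i k"
      unfolding ladder_ID_def by (elim exE conjE) (rule that; assumption)
    show ?thesis
      by (intro exI[of _ i] exI[of _ j] exI[of _ k] conjI disjI2) (rule h)+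
  qed
  then obtain i j k where *: "i < j" "{i + 1..<j} \<times> {k, k + 1} \<subseteq> D"
    "(j, k) \<in> D" "(i, k + 1) \<notin> D" "(j, k + 1) \<notin> D" "E = D - {(j, k)} \<union> {(i, k + 1)}"
    and d: "(i, k) \<notin> D \<or> (i, k) \<in> D \<and> (i, k + 2) \<notin> D \<and> ?NE i k"
    by (elim exE conjE) (rule that; assumption)
  have "(i, k + 1) \<in> E" unfolding *(6) by simp
  then have "(i, k + 1) \<in> positive_positions" "(j, k) \<in> positive_positions"
    using subsetD[OF pos(1) *(3)] subsetD[OF pos(2)] by simp_all
  then have ik: "1 \<le> i" "1 \<le> k" by (simp_all add: positive_positions_def)
  have "(i, k) \<notin> D \<or> (i, k) \<in> D \<and> (i, k + 2) \<notin> D \<and>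
      (\<forall>p q. (p, q) \<in> D \<longrightarrow> p < i \<longrightarrow> p + q \<notin> {i + k - 1, i + k, i + k + 1, i + k + 2})"
  proof (cases "(i, k) \<in> D")
    case True
    have "p + q \<notin> {i + k - 1, i + k, i + k + 1, i + k + 2}" if pq: "(p, q) \<in> D" "p < i" for p q
    proof
      assume h: "p + q \<in> {i + k - 1, i + k, i + k + 1, i + k + 2}"
      obtain k' where k': "k = Suc k'" using ik(2) by (cases k) auto
      define m where "m = p + q - i"
      have m: "m \<in> {k - 1, k, k + 1, k + 2}" "p + q = i + m"
        using h by (auto simp: m_def k')
      then have "strictly_northeast_on_antidiagonal (p, q) (i, m)"
        using pq(2) by (simp add: strictly_northeast_on_antidiagonal_def)
      moreover have "(i, m) \<in> {(i, k - 1), (i, k), (i, k + 1), (i, k + 2)}" using m(1) by simp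
      ultimately show False using d True pq(1) by blast
    qed
    then show ?thesis using d True by blast
  qed simp
  moreover have "\<forall>r. i < r \<longrightarrow> r < j \<longrightarrow> (r, k) \<in> D \<and> (r, k + 1) \<in> D"
    using *(2) by (simp add: subset_iff)
  ultimately show ?thesis using ik *
    by (intro exI[of _ i] exI[of _ j] exI[of _ k] conjI)
qed

text \<open>A letter \<open>w\<close> moves only \<open>w\<close> and \<open>Suc w\<close>, so it
  suffices that the letters \<open>a - 1\<close> to \<open>a + 2\<close> are absent. In the rows
  above, these are the four antidiagonals named in \<open>ladder_ID\<close>; in row
  \<open>i\<close>, the free cell \<open>(i, k + 2)\<close> excludes \<open>a + 2\<close>, and cells
  further right have larger letters.\<close>

lemma run_fixes_window:
  assumes r: "run (rows D 1 i @ row_seg D i (k + 2) (Suc i)) id = Some y"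
    and k: "1 \<le> k" "k < i" and n: "(i, k + 2) \<notin> D"
    and c: "\<And>p q. (p, q) \<in> D \<Longrightarrow> p < i \<Longrightarrow> p + q \<notin> {i + k - 1, i + k, i + k + 1, i + k + 2}"
    and a: "a = i + k - 1"
  shows "y a = a" "y (Suc a) = Suc a" "y (Suc (Suc a)) = Suc (Suc a)"
proof -
  let ?A = "rows D 1 i @ row_seg D i (k + 2) (Suc i)"
  have nin: "w \<noteq> a - 1 \<and> w \<noteq> a \<and> w \<noteq> Suc a \<and> w \<noteq> Suc (Suc a)" if "w \<in> set ?A" for w
    using that
  proof (unfold set_append, elim UnE)
    assume "w \<in> set (rows D 1 i)"
    then obtain r c where rc: "w = r + c - 1" "r < i" "1 \<le> r" "(r, c) \<in> D" "1 \<le> c"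
      by (auto simp: set_rows)
    then have "r + c \<notin> {i + k - 1, i + k, i + k + 1, i + k + 2}" using c by blast
    then show ?thesis using rc k unfolding a by auto
  next
    assume "w \<in> set (row_seg D i (k + 2) (Suc i))"
    then obtain c' where c': "w = i + c' - 1" "k + 2 \<le> c'" "(i, c') \<in> D"
      by (auto simp: set_row_seg)
    then have "c' \<noteq> k + 2" using n by blast
    then show ?thesis using c' k unfolding a by auto
  qed
  have a0: "a \<ge> 1" using k by (auto simp: a)
  have "y x = x" if "x \<in> {a, Suc a, Suc (Suc a)}" for x
    using r by (rule run_fix) (use nin that a0 in fastforce)+
  then show "y a = a" "y (Suc a) = Suc a" "y (Suc (Suc a)) = Suc (Suc a)" by auto
qed

text \<open>After bubbling, the two words differ at most in the pair of row \<open>i\<close>. With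
  \<open>(i, k)\<close> empty they agree literally; otherwise \<open>[a, Suc a]\<close> faces
  \<open>[Suc a, a]\<close> at a place where the half-braid relation holds.\<close>

lemma run_ladder:
  assumes lad: "ladder D E" and D: "D \<subseteq> L n \<inter> staircase n" and E: "E \<subseteq> {(r, c). c \<le> r}"
  shows "run (word n E) id = run (word n D) id"
proof -
  obtain i j k where *: "1 \<le> i" "1 \<le> k" "i < j"
    "\<forall>r. i < r \<longrightarrow> r < j \<longrightarrow> (r, k) \<in> D \<and> (r, k + 1) \<in> D"
    "(j, k) \<in> D" "(i, k + 1) \<notin> D" "(j, k + 1) \<notin> D" "E = D - {(j, k)} \<union> {(i, k + 1)}"
    and c: "(i, k) \<notin> D \<or> (i, k) \<in> D \<and> (i, k + 2) \<notin> D \<and>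
      (\<forall>p q. (p, q) \<in> D \<longrightarrow> p < i \<longrightarrow> p + q \<notin> {i + k - 1, i + k, i + k + 1, i + k + 2})"
    using ladder_rectangle[OF lad] by (elim exE conjE) (rule that; assumption)
  have k: "k < i" using E *(8) by auto
  have j: "j \<le> n" using D *(5) by (auto simp: L_def)
  let ?A = "rows D 1 i @ row_seg D i (k + 2) (Suc i)"
  let ?Z = "row_seg D i 1 k @ rows (D - {(j, k)}) (Suc i) (Suc n)"
  have 1: "run (word n D) id = run (?A @ (col_pair D i k @ [i + k]) @ ?Z) id"
    using weq_word_bubble[OF *(2) k *(3) j *(4)[rule_format] *(5,7)] invol_id unfolding weq_def by simp
  have 2: "word n E = ?A @ col_pair E i k @ ?Z"
    using word_ladder_target[OF *(2) k *(3) j *(8)] by simp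
  show ?thesis
  proof (cases "(i, k) \<in> D")
    case False
    then have "col_pair D i k @ [i + k] = col_pair E i k"
      using * by (auto simp: col_pair_def)
    then show ?thesis using 1 2 by simp
  next
    case True
    define a where "a = i + k - 1"
    have a: "Suc a = i + k" using * by (simp add: a_def)
    have m: "col_pair D i k = [a]" "col_pair E i k = [Suc a, a]"
      using True * a by (auto simp: col_pair_def a_def)
    have "run [Suc a, a] y = run [a, Suc a] y" if y: "run ?A id = Some y" for y
    proof -
      have w: "(i, k + 2) \<notin> D"
        "\<And>p q. (p, q) \<in> D \<Longrightarrow> p < i \<Longrightarrow> p + q \<notin> {i + k - 1, i + k, i + k + 1, i + k + 2}"
        using c True by blast+
      show ?thesis
        using run_swap_start[OF run_fixes_window[OF y *(2) k w a_def]] invol_run[OF y invol_id] by simp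
    qed
    then have "run (?A @ [Suc a, a] @ ?Z) id = run (?A @ [a, Suc a] @ ?Z) id"
      by (rule run_cong_middle)
    then show ?thesis using 1 2 m a by simp
  qed
qed

text \<open>A move shifts a cell up and to the right, towards the diagonal. Hence a chain that ends
  on or below the diagonal never leaves that region, although \<open>le_ID\<close> runs through
  arbitrary sets.\<close>

lemma ladder_lower:
  assumes "ladder D E" "E \<subseteq> {(r, c). c \<le> r}"
  shows "D \<subseteq> {(r, c). c \<le> r}"
proof -
  obtain i j k where "i < j" "E = D - {(j, k)} \<union> {(i, k + 1)}"
    using ladder_rectangle[OF assms(1)] by (elim exE conjE) (rule that; assumption)
  then have "D \<subseteq> insert (j, k) E" "(i, k + 1) \<in> E" by auto
  then show ?thesis using assms(2) \<open>i < j\<close> by fastforce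
qed

lemma inv_dreams_ladder:
  assumes "D \<in> inv_dreams n z" "ladder D E" "E \<subseteq> {(r, c). c \<le> r}"
  shows "E \<in> inv_dreams n z"
proof -
  have D: "D \<subseteq> L n \<inter> staircase n" using assms by (simp add: inv_dreams_def)
  obtain i j k where *: "1 \<le> i" "1 \<le> k" "i < j" "(j, k) \<in> D" "E = D - {(j, k)} \<union> {(i, k + 1)}"
    using ladder_rectangle[OF assms(2)] by (elim exE conjE) (rule that; assumption)
  have "(j, k) \<in> L n" "(j, k) \<in> staircase n" using D *(4) by blast+
  moreover have "(i, k + 1) \<in> {(r, c). c \<le> r}" using *(5) assms(3) by blast
  ultimately have "(i, k + 1) \<in> L n \<inter> staircase n"
    using *(1,2,3) by (simp add: L_def staircase_def)
  then have "E \<subseteq> L n \<inter> staircase n" unfolding *(5) using D by blast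
  then show ?thesis using assms run_ladder[OF assms(2) D assms(3)] by (simp add: inv_dreams_def)
qed

section \<open>Inverse moves\<close>

lemma inv_dreams_ladder_back:
  assumes "E \<in> inv_dreams n z" "ladder D E"
  shows "D \<in> inv_dreams n z"
proof -
  have E: "E \<subseteq> L n \<inter> staircase n" using assms by (simp add: inv_dreams_def)
  then have E': "E \<subseteq> {(r, c). c \<le> r}" by (auto simp: L_def)
  obtain i j k where *: "1 \<le> i" "1 \<le> k" "i < j"
    "\<forall>r. i < r \<longrightarrow> r < j \<longrightarrow> (r, k) \<in> D \<and> (r, k + 1) \<in> D"
    "(j, k) \<in> D" "E = D - {(j, k)} \<union> {(i, k + 1)}"
    using ladder_rectangle[OF assms(2)] by (elim exE conjE) (rule that; assumption)
  have ik: "(i, k + 1) \<in> L n \<inter> staircase n" using E *(6) by auto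
  \<comment> \<open>The new cell must stay in the staircase. It shares its antidiagonal with a cell
    of \<open>E\<close>: with \<open>(i, k + 1)\<close> if \<open>j = Suc i\<close>, and otherwise
    with \<open>(j - 1, k + 1)\<close> in the last full row.\<close>
  have "j + k \<le> n"
  proof (cases "j = Suc i")
    case True
    then show ?thesis using ik by (auto simp: staircase_def)
  next
    case False
    then have "(j - 1, k + 1) \<in> E" using *(3,6) *(4)[rule_format, of "j - 1"] by auto
    then show ?thesis using E *(3) by (auto simp: staircase_def)
  qed
  then have "(j, k) \<in> L n \<inter> staircase n"
    using ik *(1-3) by (simp add: L_def staircase_def)
  moreover have "D \<subseteq> insert (j, k) E" using *(6) by auto
  ultimately have D: "D \<subseteq> L n \<inter> staircase n" using E by blast
  then show ?thesis using assms run_ladder[OF assms(2) D E'] by (simp add: inv_dreams_def)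
qed

text \<open>Rules out an occupied landing place. The bubbled letter meets its own copy
  \<open>i + k\<close> if \<open>(i, k)\<close> is empty, and otherwise completes a braid over three
  fixed points.\<close>

lemma inv_dreams_bubble_None:
  assumes E: "E \<in> inv_dreams n z" and k: "1 \<le> k" "k < i" and j: "i < j"
    and m: "\<And>r. i < r \<Longrightarrow> r < j \<Longrightarrow> (r, k) \<in> E \<and> (r, k + 1) \<in> E"
    and E2: "(j, k) \<in> E" "(j, k + 1) \<notin> E" "(i, k + 1) \<in> E"
    and c: "(i, k) \<in> E \<Longrightarrow> (i, k + 2) \<notin> E \<and> (\<forall>p q. (p, q) \<in> E \<longrightarrow> p < i \<longrightarrow> p + q < i + k - 1)"
  shows False
proof -
  have S: "E \<subseteq> L n \<inter> staircase n" and r: "run (word n E) id = Some z"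
    using E by (auto simp: inv_dreams_def)
  have j': "j \<le> n" using S E2 by (auto simp: L_def)
  let ?A = "rows E 1 i @ row_seg E i (k + 2) (Suc i)"
  let ?Z = "row_seg E i 1 k @ rows (E - {(j, k)}) (Suc i) (Suc n)"
  have 1: "run (word n E) id = run (?A @ (col_pair E i k @ [i + k]) @ ?Z) id"
    using weq_word_bubble[OF k j j' m E2(1,2)] invol_id unfolding weq_def by simp
  define a where "a = i + k - 1"
  have a: "Suc a = i + k" using k by (simp add: a_def)
  have "run (col_pair E i k @ [i + k]) y = None" if y: "run ?A id = Some y" for y
  proof (cases "(i, k) \<in> E")
    case False
    then have "col_pair E i k @ [i + k] = [i + k, i + k]" using E2 by (simp add: col_pair_def)
    then show ?thesis using run_twice by simp
  next
    case True
    then have w: "(i, k + 2) \<notin> E" "\<And>p q. (p, q) \<in> E \<Longrightarrow> p < i \<Longrightarrow> p + q < i + k - 1"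
      using c by blast+
    have "run [Suc a, a, Suc a] y = None"
      by (rule run_braid_start_None; rule run_fixes_window[OF y k w(1) _ a_def]) (use w(2) in fastforce)+
    moreover have "col_pair E i k @ [i + k] = [Suc a, a, Suc a]" using E2 True a by (simp add: col_pair_def)
    ultimately show ?thesis by simp
  qed
  then have "run (?A @ (col_pair E i k @ [i + k]) @ ?Z) id = None" by (rule run_middle_None)
  then show False using 1 r by simp
qed

text \<open>The inverse move lands in the first row below \<open>i\<close> that is not full in both
  columns. Such a row exists because \<open>(n, k + 1)\<close> lies outside the staircase.\<close>

lemma inv_dreams_exit_row:
  assumes "E \<in> inv_dreams n z" "(i, k + 1) \<in> E"
  obtains j where "i < j" "j \<le> n" "\<not> ((j, k) \<in> E \<and> (j, k + 1) \<in> E)"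
    "\<And>r. i < r \<Longrightarrow> r < j \<Longrightarrow> (r, k) \<in> E \<and> (r, k + 1) \<in> E"
proof -
  have S: "E \<subseteq> L n \<inter> staircase n" using assms by (auto simp: inv_dreams_def)
  let ?P = "\<lambda>j. i < j \<and> \<not> ((j, k) \<in> E \<and> (j, k + 1) \<in> E)"
  have "i + (k + 1) \<le> n" "(n, k + 1) \<notin> E" using S assms(2) by (auto simp: staircase_def)
  then have n: "?P n" by simp
  then have "?P (LEAST j. ?P j)" by (rule LeastI)
  moreover have "(LEAST j. ?P j) \<le> n" using n by (rule Least_le)
  moreover have "(r, k) \<in> E \<and> (r, k + 1) \<in> E" if "i < r" "r < (LEAST j. ?P j)" for r
    using not_less_Least[OF that(2)] that(1) by blast
  ultimately show ?thesis using that by blast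
qed

lemma inv_dreams_pos: "E \<in> inv_dreams n z \<Longrightarrow> E \<subseteq> positive_positions"
proof -
  have "L n \<subseteq> positive_positions" by (auto simp: L_def positive_positions_def)
  then show "E \<in> inv_dreams n z \<Longrightarrow> E \<subseteq> positive_positions" unfolding inv_dreams_def by blast
qed

lemma ladder_PD_I:
  assumes "E \<subseteq> positive_positions" "i < j" "1 \<le> k"
    "\<And>r. i < r \<Longrightarrow> r < j \<Longrightarrow> (r, k) \<in> E \<and> (r, k + 1) \<in> E"
    "(j, k) \<notin> E" "(j, k + 1) \<notin> E" "(i, k) \<notin> E" "(i, k + 1) \<in> E"
  shows "ladder_PD (E - {(i, k + 1)} \<union> {(j, k)}) E"
proof -
  let ?D = "E - {(i, k + 1)} \<union> {(j, k)}"
  have "?D \<subseteq> positive_positions" using assms(1-3) by (auto simp: positive_positions_def)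
  moreover have "{i + 1..<j} \<times> {k, k + 1} \<subseteq> ?D" using assms(4) by auto
  moreover have "(j, k) \<in> ?D" "(i, k) \<notin> ?D" "(i, k + 1) \<notin> ?D" "(j, k + 1) \<notin> ?D"
    using assms by auto
  moreover have "E = ?D - {(j, k)} \<union> {(i, k + 1)}" using assms by auto
  ultimately show ?thesis unfolding ladder_PD_def using assms(1,2) by blast
qed

lemma ladder_ID_I:
  assumes "E \<subseteq> positive_positions" "i < j" "1 \<le> k"
    "\<And>r. i < r \<Longrightarrow> r < j \<Longrightarrow> (r, k) \<in> E \<and> (r, k + 1) \<in> E"
    "(j, k) \<notin> E" "(j, k + 1) \<notin> E" "(i, k) \<in> E" "(i, k + 1) \<in> E" "(i, k + 2) \<notin> E"
    and sm: "\<And>p q. (p, q) \<in> E \<Longrightarrow> p < i \<Longrightarrow> p + q < i + k - 1"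
  shows "ladder_ID (E - {(i, k + 1)} \<union> {(j, k)}) E"
proof -
  let ?D = "E - {(i, k + 1)} \<union> {(j, k)}"
  have "?D \<subseteq> positive_positions" using assms(1-3) by (auto simp: positive_positions_def)
  moreover have "{i + 1..<j} \<times> {k, k + 1} \<subseteq> ?D" using assms(4) by auto
  moreover have "(j, k) \<in> ?D" "(i, k) \<in> ?D" "(i, k + 1) \<notin> ?D" "(i, k + 2) \<notin> ?D" "(j, k + 1) \<notin> ?D"
    using assms(2-9) by auto
  moreover have "E = ?D - {(j, k)} \<union> {(i, k + 1)}" using assms(2-9) by auto
  moreover have "\<not> strictly_northeast_on_antidiagonal c d"
    if cd: "c \<in> ?D" "d \<in> {(i, k - 1), (i, k), (i, k + 1), (i, k + 2)}" for c d
  proof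
    obtain p q where c: "c = (p, q)" by (cases c)
    obtain m where d: "d = (i, m)" "k - 1 \<le> m" using cd(2) by auto
    assume "strictly_northeast_on_antidiagonal c d"
    then have "p < i" "p + q = i + m" using c d by (auto simp: strictly_northeast_on_antidiagonal_def)
    moreover have "(p, q) \<in> E" using cd(1) c \<open>p < i\<close> assms(2) by auto
    ultimately show False using sm[of p q] d(2) assms(3) by linarith
  qed
  ultimately show ?thesis unfolding ladder_ID_def using assms(1,2)
    by (intro conjI exI[of _ i] exI[of _ j] exI[of _ k] ballI)
qed

text \<open>Take the gap with the largest row index. In its exit row, column \<open>k + 1\<close> is
  empty, since otherwise that row would have a gap too; the landing place is free, so an inverse
  move of the first kind starts from \<open>E\<close>.\<close>

lemma left_justified:
  assumes E: "E \<in> inv_dreams n z" and min: "\<And>D. \<not> ladder D E"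
    and "(r, c + 1) \<in> E" "1 \<le> c"
  shows "(r, c) \<in> E"
proof (rule ccontr)
  assume "(r, c) \<notin> E"
  define B where "B = {i. \<exists>k. 1 \<le> k \<and> (i, k + 1) \<in> E \<and> (i, k) \<notin> E}"
  have S: "E \<subseteq> L n \<inter> staircase n" using assms by (auto simp: inv_dreams_def)
  have "B \<subseteq> {..n}" using S by (auto simp: B_def L_def)
  then have fin: "finite B" using finite_subset by blast
  have "r \<in> B" using assms \<open>(r, c) \<notin> E\<close> by (auto simp: B_def)
  define i where "i = Max B"
  have "i \<in> B" using fin \<open>r \<in> B\<close> unfolding i_def by (intro Max_in) auto
  then obtain k where k: "1 \<le> k" "(i, k + 1) \<in> E" "(i, k) \<notin> E" by (auto simp: B_def)
  have ki: "k < i" "1 \<le> i" using S k by (auto simp: L_def)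
  obtain j where j: "i < j" "j \<le> n" "\<not> ((j, k) \<in> E \<and> (j, k + 1) \<in> E)"
    "\<And>r. i < r \<Longrightarrow> r < j \<Longrightarrow> (r, k) \<in> E \<and> (r, k + 1) \<in> E"
    using inv_dreams_exit_row[OF E k(2)] by blast
  have "(j, k + 1) \<notin> E"
  proof
    assume "(j, k + 1) \<in> E"
    then have "j \<in> B" using j(3) k(1) by (auto simp: B_def)
    then show False using fin j(1) Max_ge[of B j] unfolding i_def by linarith
  qed
  moreover have "(j, k) \<notin> E"
    using inv_dreams_bubble_None[OF E k(1) ki(1) j(1) j(4)] \<open>(j, k + 1) \<notin> E\<close> k by blast
  ultimately have "ladder_PD (E - {(i, k + 1)} \<union> {(j, k)}) E"
    using j(1,4) k ki inv_dreams_pos[OF E] by (intro ladder_PD_I) auto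
  then show False using min by (auto simp: ladder_def)
qed

definition row_len :: "pos set \<Rightarrow> nat \<Rightarrow> nat" where
  "row_len E r = card {c. (r, c) \<in> E}"

lemma mem_iff_row_len:
  assumes E: "E \<in> inv_dreams n z" and min: "\<And>D. \<not> ladder D E"
  shows "(r, c) \<in> E \<longleftrightarrow> 1 \<le> c \<and> c \<le> row_len E r"
proof -
  let ?S = "{c. (r, c) \<in> E}"
  have pos: "1 \<le> c" "c \<le> n" if "c \<in> ?S" for c using that E by (auto simp: inv_dreams_def L_def)
  then have fin: "finite ?S" by (intro finite_subset[of ?S "{..n}"]) auto
  have S: "?S = {1..m}" if m: "m = (if ?S = {} then 0 else Max ?S)" for m
  proof (cases "?S = {}")
    case False
    then have mm: "m \<in> ?S" using fin m Max_in[OF fin] by auto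
    have a: "c \<in> ?S" if "1 \<le> c" "c \<le> m" for c
      using that(2,1)
    proof (induction rule: inc_induct)
      case (step c)
      then show ?case using left_justified[OF E min, of r c] by simp
    qed (use mm in simp)
    have b: "c \<le> m" if "c \<in> ?S" for c using m that fin by auto
    show ?thesis using a b pos(1) by (metis atLeastAtMost_iff set_eqI)
  qed (use m in auto)
  obtain m where m: "?S = {1..m}" using S by blast
  then have "row_len E r = m" by (simp add: row_len_def)
  then show ?thesis using m by (auto simp: set_eq_iff)
qed

text \<open>The inverse move is tried on the last two cells \<open>(i, k)\<close> and
  \<open>(i, k + 1)\<close> of the row. The 2 is the distance from the antidiagonal of
  \<open>(i, k + 1)\<close> to \<open>i + k - 1\<close>, the lowest of the four that must be empty
  above row \<open>i\<close>: if all earlier rows ended before it, the move would be legal.\<close>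

lemma row_len_bound:
  assumes E: "E \<in> inv_dreams n z" and min: "\<And>D. \<not> ladder D E" and i: "2 \<le> row_len E i"
  obtains p where "1 \<le> p" "p < i" "i + row_len E i \<le> p + row_len E p + 2"
proof -
  note mem = mem_iff_row_len[OF E min]
  have S: "E \<subseteq> L n \<inter> staircase n" using E by (auto simp: inv_dreams_def)
  define k where "k = row_len E i - 1"
  have k: "1 \<le> k" "row_len E i = k + 1" using i by (auto simp: k_def)
  have ik: "(i, k + 1) \<in> E" "(i, k) \<in> E" "(i, k + 2) \<notin> E" using k by (simp_all add: mem)
  have "(i, k + 1) \<in> L n" using ik(1) S by blast
  then have ki: "k < i" by (simp add: L_def)
  obtain j where j: "i < j" "j \<le> n" "\<not> ((j, k) \<in> E \<and> (j, k + 1) \<in> E)"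
    "\<And>r. i < r \<Longrightarrow> r < j \<Longrightarrow> (r, k) \<in> E \<and> (r, k + 1) \<in> E"
    using inv_dreams_exit_row[OF E ik(1)] by blast
  have j1: "(j, k + 1) \<notin> E" using j(3) k by (auto simp: mem)
  have "\<exists>p. 1 \<le> p \<and> p < i \<and> i + row_len E i \<le> p + row_len E p + 2"
  proof (rule ccontr)
    assume "\<nexists>p. 1 \<le> p \<and> p < i \<and> i + row_len E i \<le> p + row_len E p + 2"
    then have lt: "p + row_len E p + 2 < i + row_len E i" if "1 \<le> p" "p < i" for p
      using that by (meson not_le)
    have sm: "p + q < i + k - 1" if "(p, q) \<in> E" "p < i" for p q
    proof -
      have "(p, q) \<in> L n" using S that by blast
      then have "1 \<le> p" by (simp add: L_def)
      moreover have "q \<le> row_len E p" using that(1) by (simp add: mem)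
      ultimately show ?thesis using lt[of p] that(2) k by linarith
    qed
    have "(j, k) \<notin> E"
      using inv_dreams_bubble_None[OF E k(1) ki j(1) j(4) _ j1 ik(1)] ik sm by blast
    then have "ladder_ID (E - {(i, k + 1)} \<union> {(j, k)}) E"
      using j(1,4) k ki j1 ik sm inv_dreams_pos[OF E] by (intro ladder_ID_I) auto
    then show False using min by (auto simp: ladder_def)
  qed
  then show ?thesis using that by blast
qed

subsection \<open>Left-justified rows\<close>

text \<open>After the first \<open>i\<close> rows of a left-justified dream, the positions \<open>i + 1, \<dots>, i + q\<close> hold the
  partners that are still pending, sorted by the points \<open>\<le> i\<close> they belong to.  The next row closes one
  of these pairs, adds a fixed point, or opens a new pair at the end of the queue.\<close>

definition queue :: "nat \<Rightarrow> nat \<Rightarrow> (nat \<Rightarrow> nat) \<Rightarrow> bool" where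
  "queue i q y \<longleftrightarrow> invol y \<and> y 0 = 0 \<and> (\<forall>t. i < t \<and> t \<le> i + q \<longrightarrow> y t \<le> i) \<and>
     (\<forall>s t. i < s \<and> s < t \<and> t \<le> i + q \<longrightarrow> y s < y t) \<and> (\<forall>t. i + q < t \<longrightarrow> y t = t)"

text \<open>The effect on lines of reading a left-justified row \<open>i\<close> of length
  \<open>m\<close>, whose letters are \<open>i + m - 1\<close> down to \<open>i\<close>.\<close>

definition cycle_down :: "nat \<Rightarrow> nat \<Rightarrow> nat \<Rightarrow> nat" where
  "cycle_down i m t = (if t = i + m then i else if i \<le> t \<and> t < i + m then Suc t else t)"

text \<open>Every letter finds a point whose partner is below \<open>i\<close>, so all steps are
  conjugations. Stating the result as an intertwining relation avoids the inverse of the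
  cycle.\<close>

lemma run_descend:
  "(\<And>t. i \<le> t \<Longrightarrow> t < i + m \<Longrightarrow> y t < i \<and> y t < y (i + m)) \<Longrightarrow> invol y \<Longrightarrow>
    \<exists>y'. run (rev [i..<i + m]) y = Some y' \<and> (\<forall>t. y' (cycle_down i m t) = cycle_down i m (y t))"
proof (induction m arbitrary: y)
  case 0
  then show ?case by (auto simp: cycle_down_def)
next
  case (Suc m)
  let ?k = "i + m"
  define y1 where "y1 = adj ?k \<circ> y \<circ> adj ?k"
  have k: "y ?k < i" "y ?k < y (Suc ?k)" using Suc.prems(1)[of ?k] by auto
  have y1: "iconj ?k y = y1" using k by (auto simp: iconj_def y1_def)
  have nk: "y (Suc ?k) \<noteq> ?k" using k Suc.prems(2) by (metis invol_def not_add_less1 Suc_n_not_le_n le_SucI less_imp_le)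
  have "y1 t < i \<and> y1 t < y1 ?k" if t: "i \<le> t" "t < ?k" for t
  proof -
    have yt: "y t < i" "y t < y (Suc ?k)" using Suc.prems(1)[of t] t by auto
    then have "y1 t = y t" using t by (simp add: y1_def adj_if)
    moreover have "y1 ?k = ?k \<or> y1 ?k = y (Suc ?k)" using nk by (auto simp: y1_def adj_if)
    ultimately show ?thesis using yt by auto
  qed
  then obtain y' where y': "run (rev [i..<?k]) y1 = Some y'" "\<And>t. y' (cycle_down i m t) = cycle_down i m (y1 t)"
    using Suc.IH[of y1] invol_iconj[OF Suc.prems(2), of ?k] y1 by auto
  have cycle_down: "cycle_down i (Suc m) t = cycle_down i m (adj ?k t)" for t
    by (auto simp: cycle_down_def adj_if)
  have "y' (cycle_down i (Suc m) t) = cycle_down i (Suc m) (y t)" for t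
    unfolding cycle_down y'(2) by (simp add: y1_def)
  then show ?case using y'(1) k y1 by auto
qed

lemma queue_open_eq:
  assumes "queue i q y"
  shows "{p \<in> {1..i}. i < y p \<and> p < v} = y ` {t \<in> {i<..i + q}. y t < v}"
proof -
  have yy: "y (y x) = x" for x using assms by (auto simp: queue_def invol_def)
  have "p \<in> y ` {t \<in> {i<..i + q}. y t < v}" if "p \<in> {1..i}" "i < y p" "p < v" for p
  proof -
    have "y p \<le> i + q"
    proof (rule ccontr)
      assume "\<not> y p \<le> i + q"
      then have "y (y p) = y p" using assms unfolding queue_def by auto
      then show False using yy[of p] that by auto
    qed
    then show ?thesis using that yy[of p] by (intro image_eqI[of _ _ "y p"]) auto
  qed
  moreover have "y t \<in> {1..i} \<and> i < y (y t)" if "t \<in> {i<..i + q}" for t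
  proof -
    have "y t \<noteq> 0"
    proof
      assume "y t = 0"
      then have "y 0 = t" using yy[of t] by simp
      then show False using assms that by (auto simp: queue_def)
    qed
    then show ?thesis using that assms yy[of t] by (auto simp: queue_def)
  qed
  ultimately show ?thesis by auto
qed

lemma queue_card_open:
  assumes "queue i q y"
  shows "card {p \<in> {1..i}. i < y p \<and> p < v} = card {t \<in> {i<..i + q}. y t < v}"
proof -
  have "inj_on y {t \<in> {i<..i + q}. y t < v}"
    using assms by (intro inj_onI) (metis invol_inj queue_def)
  then show ?thesis using queue_open_eq[OF assms] by (simp add: card_image)
qed

text \<open>For \<open>l < q\<close> the row pulls the pending line \<open>Suc h + l\<close> down to
  \<open>Suc h\<close> and closes its pair. For \<open>l = q\<close> that line is the first
  untouched one, which gives a fixed point. For \<open>l = Suc q\<close> the first letter pairs two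
  untouched lines, and the remaining letters pull the smaller one down. As the queue is sorted,
  \<open>l\<close> can be read off afterwards as a count of open points.\<close>

lemma queue_step:
  assumes Q: "queue h q y" and l: "l \<le> Suc q"
  shows "\<exists>y' q'. run (rev [Suc h..<Suc h + l]) y = Some y' \<and> queue (Suc h) q' y' \<and> l \<le> q' \<and> q \<le> Suc q' \<and>
    l = card {p \<in> {1..Suc h}. Suc h < y' p \<and> p < y' (Suc h)} \<and>
    (\<forall>p\<le>h. y p \<le> h \<longrightarrow> y' p = y p) \<and>
    (\<forall>p\<le>h. h < y p \<longrightarrow> h < y' p) \<and>
    (\<forall>p\<le>h. h < y p \<longrightarrow> y p \<noteq> Suc h + l \<longrightarrow> Suc h < y' p) \<and>
    (l < q \<longrightarrow> y' (Suc h) = y (Suc h + l)) \<and> (l = q \<longrightarrow> y' (Suc h) = Suc h) \<and>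
    (l = Suc q \<longrightarrow> Suc h < y' (Suc h))"
proof -
  let ?i = "Suc h"
  have iv: "invol y" and y0: "y 0 = 0"
    and q1: "\<And>t. h < t \<Longrightarrow> t \<le> h + q \<Longrightarrow> y t \<le> h"
    and q2: "\<And>s t. h < s \<Longrightarrow> s < t \<Longrightarrow> t \<le> h + q \<Longrightarrow> y s < y t"
    and q3: "\<And>t. h + q < t \<Longrightarrow> y t = t"
    using Q by (auto simp: queue_def)
  have q1': "y (t - 1) \<le> h" if "?i < t" "t \<le> ?i + q" for t
    by (rule q1) (use that in linarith)+
  have q2': "y (s - 1) < y (t - 1)" if "?i < s" "s < t" "t \<le> ?i + q" for s t
    by (rule q2) (use that in linarith)+
  have q2'': "y (s - 1) < y t" if "?i < s" "s \<le> t" "t \<le> h + q" for s t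
    by (rule q2) (use that in linarith)+
  have card_all: "card {t \<in> {i<..i + r}. y' t < v} = r" if "\<And>t. i < t \<Longrightarrow> t \<le> i + r \<Longrightarrow> y' t < v"
    for i r v and y' :: "nat \<Rightarrow> nat"
  proof -
    have "{t \<in> {i<..i + r}. y' t < v} = {i<..i + r}" using that by auto
    then show ?thesis by simp
  qed
  show ?thesis
  proof (cases "l \<le> q")
    case True
    have "y t < ?i \<and> y t < y (?i + l)" if "?i \<le> t" "t < ?i + l" for t
      using q1[of t] q2[of t "?i + l"] q3[of "?i + l"] that True by (cases "l = q") auto
    then obtain y' where r: "run (rev [?i..<?i + l]) y = Some y'"
      and y': "\<And>t. y' (cycle_down ?i l t) = cycle_down ?i l (y t)"
      using run_descend[of ?i l y] iv by blast
    have iv': "invol y'" using invol_run[OF r iv] .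
    have lowrot: "cycle_down ?i l t = t" if "t \<le> h" for t using that by (simp add: cycle_down_def)
    have low: "y' t = cycle_down ?i l (y t)" if "t \<le> h" for t using y'[of t] lowrot[OF that] by simp
    have mid: "y' (Suc t) = y t" if "h < t" "t \<le> h + l" for t
      using y'[of t] that True lowrot[of "y t"] q1[of t] by (simp add: cycle_down_def)
    have high: "y' t = cycle_down ?i l (y t)" if "?i + l < t" for t
      using y'[of t] that by (simp add: cycle_down_def)
    have at: "y' ?i = cycle_down ?i l (y (?i + l))" using y'[of "?i + l"] by (simp add: cycle_down_def)
    have c1: "\<forall>p\<le>h. y p \<le> h \<longrightarrow> y' p = y p" using low lowrot by simp
    have c2: "\<forall>p\<le>h. h < y p \<longrightarrow> h < y' p" using low by (simp add: cycle_down_def)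
    have c3: "\<forall>p\<le>h. h < y p \<longrightarrow> y p \<noteq> ?i + l \<longrightarrow> ?i < y' p" using low by (simp add: cycle_down_def)
    show ?thesis
    proof (cases "l < q")
      case lt: True
      have at': "y' ?i = y (?i + l)" using at lowrot q1[of "?i + l"] lt by simp
      have high': "y' t = y t" if "?i + l < t" "t \<le> h + q" for t
        using high[OF that(1)] lowrot q1[of t] that by simp
      have pre: "y' t = y (if t \<le> ?i + l then t - 1 else t)" if "?i < t" "t \<le> h + q" for t
        using that mid[of "t - 1"] high'[of t] by auto
      have e: "?i + (q - 1) = h + q" using lt by simp
      have Q': "queue ?i (q - 1) y'"
        unfolding queue_def e
      proof (intro conjI allI impI iv')
        show "y' 0 = 0" using c1 y0 by simp
        fix t
        show "y' t \<le> ?i" if "?i < t \<and> t \<le> h + q"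
          using that pre[of t] q1[of t] q1'[of t] by (auto split: if_splits)
        show "y' s < y' t" if "?i < s \<and> s < t \<and> t \<le> h + q" for s
          using that pre[of t] pre[of s] q2[of s t] q2'[of s t] q2''[of s t]
          by (auto split: if_splits)
        show "y' t = t" if "h + q < t"
          using that lt high[of t] q3[of t] by (simp add: cycle_down_def)
      qed
      have "{t \<in> {?i<..h + q}. y' t < y (?i + l)} = {?i<..?i + l}"
      proof (intro set_eqI iffI)
        fix t assume t: "t \<in> {t \<in> {?i<..h + q}. y' t < y (?i + l)}"
        show "t \<in> {?i<..?i + l}"
        proof (rule ccontr)
          assume "t \<notin> {?i<..?i + l}"
          then have "?i + l < t" "t \<le> h + q" using t by auto
          then show False using t high'[of t] q2[of "?i + l" t] by auto
        qed
      next
        fix t assume "t \<in> {?i<..?i + l}"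
        then show "t \<in> {t \<in> {?i<..h + q}. y' t < y (?i + l)}"
          using pre[of t] q2''[of t "?i + l"] lt by auto
      qed
      then have "card {p \<in> {1..?i}. ?i < y' p \<and> p < y' ?i} = l"
        using queue_card_open[OF Q', of "y (?i + l)"] at' unfolding e by simp
      then show ?thesis
        using r Q' lt c1 c2 c3 at' by (intro exI[of _ y'] exI[of _ "q - 1"]) auto
    next
      case False
      then have lq: "l = q" using True by simp
      have at': "y' ?i = ?i" using at q3[of "?i + l"] lq by (simp add: cycle_down_def)
      have pre: "y' t = y (t - 1)" if "?i < t" "t \<le> ?i + q" for t
        using mid[of "t - 1"] that lq by (cases t) auto
      have Q': "queue ?i q y'"
        unfolding queue_def
      proof (intro conjI allI impI iv')
        show "y' 0 = 0" using c1 y0 by simp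
        fix t
        show "y' t \<le> ?i" if "?i < t \<and> t \<le> ?i + q"
          using that pre[of t] q1'[of t] by auto
        show "y' s < y' t" if "?i < s \<and> s < t \<and> t \<le> ?i + q" for s
          using that pre[of t] pre[of s] q2'[of s t] by auto
        show "y' t = t" if "?i + q < t"
          using that lq high[of t] q3[of t] by (simp add: cycle_down_def)
      qed
      have "y' t < y' ?i" if "?i < t" "t \<le> ?i + q" for t
        using pre[OF that] q1'[of t] that at' by auto
      then have "card {p \<in> {1..?i}. ?i < y' p \<and> p < y' ?i} = l"
        using queue_card_open[OF Q', of "y' ?i"] card_all[of ?i q y' "y' ?i"] lq by simp
      then show ?thesis
        using r Q' lq c1 c2 c3 at' by (intro exI[of _ y'] exI[of _ q]) auto
    qed
  next
    case False
    then have lq: "l = Suc q" using l by simp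
    let ?m = "?i + q"
    have fx: "y ?m = ?m" "y (Suc ?m) = Suc ?m" using q3 by auto
    define y1 where "y1 = y \<circ> adj ?m"
    have y1: "iconj ?m y = y1" using fx by (simp add: iconj_def y1_def)
    have iv1: "invol y1" using invol_iconj[OF iv, of ?m] y1 by simp
    have y1o: "y1 t = y t" if "t \<noteq> ?m" "t \<noteq> Suc ?m" for t using that by (simp add: y1_def adj_other)
    have y1m: "y1 ?m = Suc ?m" "y1 (Suc ?m) = ?m" using fx by (auto simp: y1_def)
    have "y1 t < ?i \<and> y1 t < y1 ?m" if "?i \<le> t" "t < ?m" for t
      using q1[of t] that y1m y1o[of t] by auto
    then obtain y' where r1: "run (rev [?i..<?m]) y1 = Some y'"
      and y': "\<And>t. y' (cycle_down ?i q t) = cycle_down ?i q (y1 t)"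
      using run_descend[of ?i q y1] iv1 by blast
    have r: "run (rev [?i..<?i + l]) y = Some y'" using r1 fx y1 lq by simp
    have iv': "invol y'" using invol_run[OF r iv] .
    have lowrot: "cycle_down ?i q t = t" if "t \<le> h" for t using that by (simp add: cycle_down_def)
    have low: "y' t = cycle_down ?i q (y t)" if "t \<le> h" for t
      using y'[of t] lowrot[OF that] y1o[of t] that by simp
    have pre: "y' t = y (t - 1)" if "?i < t" "t \<le> ?m" for t
    proof -
      have "y' (cycle_down ?i q (t - 1)) = cycle_down ?i q (y (t - 1))" using y'[of "t - 1"] y1o[of "t - 1"] that by simp
      moreover have "cycle_down ?i q (t - 1) = t" using that by (auto simp: cycle_down_def)
      ultimately show ?thesis using lowrot q1'[OF that] by simp
    qed
    have at: "y' ?i = Suc ?m" using y'[of "?m"] y1m by (simp add: cycle_down_def)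
    have last: "y' (Suc ?m) = ?i" using y'[of "Suc ?m"] y1m by (simp add: cycle_down_def)
    have c1: "\<forall>p\<le>h. y p \<le> h \<longrightarrow> y' p = y p" using low lowrot by simp
    have c2: "\<forall>p\<le>h. h < y p \<longrightarrow> h < y' p" using low by (simp add: cycle_down_def)
    have nm: "y p \<noteq> ?m" if "p \<le> h" for p using fx iv that invol_eq_iff[of y p ?m] by auto
    have c3: "?i < y' p" if "p \<le> h" "h < y p" for p
      using low[OF that(1)] nm[OF that(1)] that(2) by (auto simp: cycle_down_def)
    have Q': "queue ?i (Suc q) y'"
      unfolding queue_def
    proof (intro conjI allI impI iv')
      show "y' 0 = 0" using c1 y0 by simp
      fix t
      have a: "y' t \<le> h" if "?i < t" "t \<le> ?m"
        using that pre[of t] q1'[of t] by auto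
      show "y' t \<le> ?i" if "?i < t \<and> t \<le> ?i + Suc q"
        using that a last by (cases "t = Suc ?m") auto
      have b: "y' s \<le> h" if "?i < s" "s \<le> ?m" for s
        using that pre[of s] q1'[of s] by auto
      show "y' s < y' t" if "?i < s \<and> s < t \<and> t \<le> ?i + Suc q" for s
        using that b[of s] last pre[of s] pre[of t] q2'[of s t]
        by (cases "t = Suc ?m") auto
      show "y' t = t" if "?i + Suc q < t"
        using that y'[of t] q3[of t] y1o[of t] by (simp add: cycle_down_def)
    qed
    have "y' t < y' ?i" if "?i < t" "t \<le> ?i + Suc q" for t
      using Q' that at unfolding queue_def by fastforce
    then have "card {p \<in> {1..?i}. ?i < y' p \<and> p < y' ?i} = l"
      using queue_card_open[OF Q', of "y' ?i"] card_all[of ?i "Suc q" y' "y' ?i"] lq by simp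
    then show ?thesis
      using r Q' lq c1 c2 c3 at by (intro exI[of _ y'] exI[of _ "Suc q"]) simp
  qed
qed

subsection \<open>The bottom element\<close>

text \<open>The form of \<open>c_hat\<close> that counts the points \<open>p \<le> i\<close> instead
  of their pending partners, whose positions are still shifted by later rows.\<close>

definition open_below :: "(nat \<Rightarrow> nat) \<Rightarrow> nat \<Rightarrow> nat" where
  "open_below y i = card {p \<in> {1..i}. i < y p \<and> p < y i}"

lemma involutionsD:
  assumes "z \<in> involutions n"
  shows "z permutes {1..n}" "z (z x) = x" "z x \<in> {1..n} \<longleftrightarrow> x \<in> {1..n}"
proof -
  show p: "z permutes {1..n}" using assms by (simp add: involutions_def)
  have "z = inv z" using assms by (simp add: involutions_def)
  then show "z (z x) = x" using permutes_inverses(2)[OF p, of x] by simp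
  show "z x \<in> {1..n} \<longleftrightarrow> x \<in> {1..n}" using permutes_in_image[OF p] .
qed

text \<open>The involution itself is the bijection between the two counted sets.\<close>

lemma c_hat_eq:
  assumes z: "z \<in> involutions n" and i: "i \<in> {1..n}"
  shows "c_hat n z i = open_below z i"
proof -
  note zz = involutionsD(2)[OF z] and zn = involutionsD(3)[OF z]
  let ?A = "{j \<in> {1..n}. j > i \<and> z i > z j \<and> i \<ge> z j}"
  have "{p \<in> {1..i}. i < z p \<and> p < z i} = z ` ?A"
  proof (intro set_eqI iffI)
    fix p assume p: "p \<in> {p \<in> {1..i}. i < z p \<and> p < z i}"
    then have "z p \<in> ?A" using zz[of p] zn[of p] i by simp
    then show "p \<in> z ` ?A" by (rule rev_image_eqI) (simp add: zz)
  next
    fix p assume "p \<in> z ` ?A"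
    then obtain j where j: "p = z j" "j \<in> ?A" by (rule imageE)
    then have "z p = j" using zz[of j] by simp
    then show "p \<in> {p \<in> {1..i}. i < z p \<and> p < z i}" using j zn[of j] by simp
  qed
  moreover have "inj_on z ?A" by (rule inj_onI) (metis zz)
  ultimately show ?thesis by (simp add: c_hat_def open_below_def card_image)
qed

lemma row_seg_full:
  assumes "\<And>c. 1 \<le> c \<Longrightarrow> c \<le> r \<Longrightarrow> (r, c) \<in> E \<longleftrightarrow> c \<le> m" "m \<le> r"
  shows "row_seg E r 1 (Suc r) = rev [r..<r + m]"
proof -
  have "row_seg E r 1 (Suc r) = row_seg E r (Suc m) (Suc r) @ row_seg E r 1 (Suc m)"
    using assms(2) by (intro row_seg_append) auto
  also have "row_seg E r (Suc m) (Suc r) = []"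
    using assms by (auto simp: row_seg_def filter_empty_conv)
  also have "filter (\<lambda>c. (r, c) \<in> E) (rev [1..<Suc m]) = rev [1..<Suc m]"
    using assms by (auto simp: filter_id_conv)
  then have "row_seg E r 1 (Suc m) = map (\<lambda>c. r + c - 1) (rev [1..<Suc m])"
    unfolding row_seg_def by simp
  also have "map (\<lambda>c. r + c - 1) (rev [1..<Suc m]) = rev [r..<r + m]"
    by (induction m) auto
  finally show ?thesis by simp
qed

text \<open>For points up to \<open>h\<close>, each comparison in the count is decided by a closed
  value or by the mere fact that a value exceeds \<open>h\<close>. Later rows respect both.\<close>

lemma open_below_cong:
  assumes "\<forall>r\<le>h. y r \<le> h \<longrightarrow> y' r = y r" "\<forall>r\<le>h. h < y r \<longrightarrow> h < y' r" "p \<le> h"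
  shows "open_below y' p = open_below y p"
proof -
  have "p < y' r \<longleftrightarrow> p < y r" if "r \<le> p" for r
    using assms that by (metis le_trans not_le)
  moreover have "r < y' p \<longleftrightarrow> r < y p" if "r \<le> p" for r
    using assms that by (metis le_trans not_le)
  ultimately show ?thesis unfolding open_below_def
    by (intro arg_cong[of _ _ card]) auto
qed

lemma minimal_inv_dream:
  assumes z: "z \<in> involutions n" and E: "E \<in> inv_dreams n z" and min: "\<And>D. \<not> ladder D E"
  shows "E = D_hat_bot n z"
proof -
  note mem = mem_iff_row_len[OF E min]
  have EL: "E \<subseteq> L n" and r: "run (word n E) id = Some z" using E by (auto simp: inv_dreams_def)
  have len: "row_len E r \<le> r" for r
  proof (cases "row_len E r = 0")
    case False
    then have "(r, row_len E r) \<in> L n" using EL mem[of r "row_len E r"] by auto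
    then show ?thesis by (simp add: L_def)
  qed simp
  have row: "row_seg E r 1 (Suc r) = rev [r..<r + row_len E r]" for r
    by (rule row_seg_full) (use len mem in auto)
  \<comment> \<open>The bound \<open>p + row_len E p \<le> i + q\<close> is carried to feed
    \<open>row_len_bound\<close>: for the next row of length \<open>l\<close> it yields
    \<open>Suc h + l \<le> h + q + 2\<close>, hence \<open>l \<le> Suc q\<close>, the range of
    \<open>queue_step\<close>.\<close>
  have "\<exists>y q. run (rows E 1 (Suc i)) id = Some y \<and> queue i q y \<and>
      (\<forall>p. 1 \<le> p \<longrightarrow> p \<le> i \<longrightarrow> p + row_len E p \<le> i + q \<and> row_len E p = open_below y p)" if "i \<le> n" for i
    using that
  proof (induction i)
    case 0
    show ?case by (intro exI[of _ id] exI[of _ 0]) (auto simp: rows_def queue_def invol_def)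
  next
    case (Suc h)
    then obtain y q where y: "run (rows E 1 (Suc h)) id = Some y" "queue h q y"
      and b: "\<And>p. 1 \<le> p \<Longrightarrow> p \<le> h \<Longrightarrow> p + row_len E p \<le> h + q \<and> row_len E p = open_below y p"
      using Suc_leD by blast
    let ?l = "row_len E (Suc h)"
    have "?l \<le> Suc q"
    proof (cases "2 \<le> ?l")
      case True
      then obtain p where "1 \<le> p" "p < Suc h" "Suc h + ?l \<le> p + row_len E p + 2"
        using row_len_bound[OF E min] by blast
      then show ?thesis using b[of p] by simp
    qed simp
    then obtain y' q' where y': "run (rev [Suc h..<Suc h + ?l]) y = Some y'" "queue (Suc h) q' y'"
      "?l \<le> q'" "q \<le> Suc q'" "?l = open_below y' (Suc h)"
      "\<forall>p\<le>h. y p \<le> h \<longrightarrow> y' p = y p" "\<forall>p\<le>h. h < y p \<longrightarrow> h < y' p"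
      using queue_step[OF y(2)] unfolding open_below_def by blast
    have "run (rows E 1 (Suc (Suc h))) id = Some y'"
      using y(1) y'(1) row[of "Suc h"] by (simp add: rows_Suc run_append)
    moreover have "p + row_len E p \<le> Suc h + q' \<and> row_len E p = open_below y' p"
      if "1 \<le> p" "p \<le> Suc h" for p
    proof (cases "p = Suc h")
      case False
      then show ?thesis using b[of p] that y'(4) open_below_cong[OF y'(6,7), of p] by auto
    qed (use y' in auto)
    ultimately show ?case using y'(2) by blast
  qed
  from this[of n] r have len: "row_len E p = open_below z p" if "1 \<le> p" "p \<le> n" for p
    using that by (auto simp: word_rows)
  show ?thesis
  proof (intro set_eqI)
    fix c :: pos
    obtain i j where c: "c = (i, j)" by (cases c)
    have "(i, j) \<in> E \<longleftrightarrow> (i, j) \<in> {1..n} \<times> {1..n} \<and> (i, j) \<in> E"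
      using EL by (auto simp: L_def)
    also have "\<dots> \<longleftrightarrow> (i, j) \<in> {1..n} \<times> {1..n} \<and> j \<le> c_hat n z i"
      using len[of i] c_hat_eq[OF z, of i] mem[of i j] by auto
    finally show "c \<in> E \<longleftrightarrow> c \<in> D_hat_bot n z" by (simp add: c D_hat_bot_def)
  qed
qed

lemma D_hat_bot_inv_dream:
  assumes z: "z \<in> involutions n"
  shows "D_hat_bot n z \<in> inv_dreams n z"
proof -
  note zz = involutionsD(2)[OF z] and zn = involutionsD(3)[OF z]
  have z0: "z 0 = 0" using involutionsD(1)[OF z] by (auto simp: permutes_def)
  let ?E = "D_hat_bot n z"
  have ch: "c_hat n z i \<le> i" "i + c_hat n z i \<le> n" if "i \<in> {1..n}" for i
  proof -
    have "open_below z i \<le> card {1..i}" unfolding open_below_def by (rule card_mono) auto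
    then show "c_hat n z i \<le> i" using c_hat_eq[OF z that] by simp
    have "c_hat n z i \<le> card {i<..n}" unfolding c_hat_def by (rule card_mono) auto
    then show "i + c_hat n z i \<le> n" using that unfolding card_greaterThanAtMost atLeastAtMost_iff by linarith
  qed
  have S: "?E \<subseteq> L n \<inter> staircase n"
  proof
    fix c assume "c \<in> ?E"
    then obtain i j where c: "c = (i, j)" "i \<in> {1..n}" "j \<in> {1..n}" "j \<le> c_hat n z i"
      by (auto simp: D_hat_bot_def)
    then show "c \<in> L n \<inter> staircase n" using ch[of i] by (auto simp: L_def staircase_def)
  qed
  have row: "row_seg ?E r 1 (Suc r) = rev [r..<r + open_below z r]" if "r \<in> {1..n}" for r
    by (rule row_seg_full) (use ch[OF that] c_hat_eq[OF z that] that in \<open>auto simp: D_hat_bot_def\<close>)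
  \<comment> \<open>Before the last row, \<open>y\<close> can be expected to agree with
    \<open>z\<close> only on closed pairs; for the other points just their being open is
    compared.\<close>
  have "\<exists>y q. run (rows ?E 1 (Suc i)) id = Some y \<and> queue i q y \<and>
      (\<forall>p\<le>i. z p \<le> i \<longrightarrow> y p = z p) \<and> (\<forall>p\<le>i. i < z p \<longrightarrow> i < y p)" if "i \<le> n" for i
    using that
  proof (induction i)
    case 0
    show ?case by (intro exI[of _ id] exI[of _ 0]) (auto simp: rows_def queue_def invol_def z0)
  next
    case (Suc h)
    let ?i = "Suc h"
    obtain y q where y: "run (rows ?E 1 ?i) id = Some y" "queue h q y"
      and zl: "\<And>p. p \<le> h \<Longrightarrow> z p \<le> h \<Longrightarrow> y p = z p" and zg: "\<And>p. p \<le> h \<Longrightarrow> h < z p \<Longrightarrow> h < y p"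
      using Suc.IH[OF Suc_leD[OF Suc.prems]] by blast
    have yy: "y (y x) = x" for x using y(2) by (auto simp: queue_def invol_def)
    have fx: "y t = t" if "h + q < t" for t using y(2) that by (auto simp: queue_def)
    have yq: "y p \<le> h + q" if "p \<le> h" for p
      using fx[of "y p"] yy[of p] that by (metis le_add1 le_trans not_le)
    \<comment> \<open>The involution \<open>z\<close> selects the case of \<open>queue_step\<close>:
      the offset of the pending partner of \<open>z ?i\<close> in the queue, a fixed point, or a new
      pair. That \<open>l\<close> is the row length of the bottom element follows afterwards from
      \<open>open_below\<close>.\<close>
    define l where "l = (if z ?i < ?i then y (z ?i) - ?i else if z ?i = ?i then q else Suc q)"
    have cl: "z ?i \<le> h \<and> y (z ?i) = ?i + l \<and> l < q" if "z ?i < ?i"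
    proof -
      have "h < y (z ?i)" using that zg[of "z ?i"] zz[of ?i] by simp
      then show ?thesis using that yq[of "z ?i"] by (simp add: l_def)
    qed
    have "l \<le> Suc q" using cl by (auto simp: l_def)
    then obtain y' q' where y': "run (rev [?i..<?i + l]) y = Some y'" "queue ?i q' y'"
      "l = open_below y' ?i"
      and s: "\<forall>p\<le>h. y p \<le> h \<longrightarrow> y' p = y p"
      "\<forall>p\<le>h. h < y p \<longrightarrow> y p \<noteq> ?i + l \<longrightarrow> ?i < y' p"
      "l < q \<longrightarrow> y' ?i = y (?i + l)" "l = q \<longrightarrow> y' ?i = ?i" "l = Suc q \<longrightarrow> ?i < y' ?i"
      using queue_step[OF y(2)] unfolding open_below_def by blast
    have yy': "y' (y' x) = x" for x using y'(2) by (auto simp: queue_def invol_def)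
    have ii: "z ?i < ?i \<Longrightarrow> y' ?i = z ?i" "z ?i = ?i \<Longrightarrow> y' ?i = ?i" "?i < z ?i \<Longrightarrow> ?i < y' ?i"
      using cl s(3,4,5) yy[of "z ?i"] by (auto simp: l_def)
    have R1: "y' p = z p" if p: "p \<le> ?i" "z p \<le> ?i" for p
    proof -
      consider "p = ?i" | "p \<le> h" "z p \<le> h" | "p \<le> h" "z p = ?i" using p by linarith
      then show ?thesis
      proof cases
        case 1 then show ?thesis using ii p by (cases "z ?i < ?i") auto
      next
        case 2 then show ?thesis using zl[of p] s(1) by simp
      next
        case 3
        then have zi: "z ?i = p" using zz[of p] by simp
        then have "y' ?i = p" using ii(1) 3 by simp
        then show ?thesis using yy'[of ?i] 3 by simp
      qed
    qed
    have R2: "?i < y' p" if p: "p \<le> ?i" "?i < z p" for p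
    proof (cases "p = ?i")
      case True then show ?thesis using ii p by auto
    next
      case False
      then have ph: "p \<le> h" using p by simp
      have "y p \<noteq> ?i + l"
      proof
        assume a: "y p = ?i + l"
        show False
        proof (cases "z ?i < ?i")
          case True
          then have "z ?i = p" using cl a yy by metis
          then show False using zz[of ?i] p by simp
        next
          case False
          then have "q \<le> l" by (auto simp: l_def)
          then have "y (y p) = y p" using fx[of "y p"] a by simp
          then show False using yy[of p] a ph by simp
        qed
      qed
      then show ?thesis using s(2) zg[OF ph] ph p by simp
    qed
    have "open_below y' ?i = open_below z ?i"
      by (rule open_below_cong[of ?i]) (use R1 R2 in auto)
    then have "row_seg ?E ?i 1 (Suc ?i) = rev [?i..<?i + l]" using row[of ?i] y'(3) Suc.prems by simp
    then have "run (rows ?E 1 (Suc ?i)) id = Some y'"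
      using y(1) y'(1) by (simp add: rows_Suc run_append)
    then show ?case using y'(2) R1 R2 by blast
  qed
  from this[of n] obtain y q where y: "run (word n ?E) id = Some y" "queue n q y"
      "\<forall>p\<le>n. z p \<le> n \<longrightarrow> y p = z p"
    by (auto simp: word_rows)
  have zle: "z p \<le> n" if "p \<le> n" for p using zn[of p] z0 that by (cases "p = 0") auto
  have yy: "y (y x) = x" for x using y(2) by (auto simp: queue_def invol_def)
  have "y p = z p" for p
  proof (cases "p \<le> n")
    case True then show ?thesis using y(3) zle by simp
  next
    case False
    then have zp: "z p = p" using involutionsD(1)[OF z] by (auto simp: permutes_def)
    have "\<not> y p \<le> n" using y(3) zle[of "y p"] yy[of p] False by auto
    then have "y p = p" using y(2) False unfolding queue_def by (metis not_le)
    then show ?thesis using zp by simp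
  qed
  then have "y = z" by blast
  then show ?thesis using S y(1) by (simp add: inv_dreams_def)
qed

section \<open>The bottom element as the unique minimum\<close>

lemma ladder_sum_less:
  assumes "ladder D E" "finite D"
  shows "sum snd D < sum snd E"
proof -
  obtain i j k where *: "i < j" "(j, k) \<in> D" "(i, k + 1) \<notin> D" "E = D - {(j, k)} \<union> {(i, k + 1)}"
    using ladder_rectangle[OF assms(1)] by (elim exE conjE) (rule that; assumption)
  have "sum snd D = k + sum snd (D - {(j, k)})" using assms(2) *(2) by (simp add: sum.remove)
  moreover have "sum snd E = (k + 1) + sum snd (D - {(j, k)})"
    unfolding *(4) using assms(2) *(3) by simp
  ultimately show ?thesis by simp
qed

lemma finite_inv_dream: "E \<in> inv_dreams n z \<Longrightarrow> finite E"
proof -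
  have "L n \<subseteq> {1..n} \<times> {1..n}" by (auto simp: L_def)
  then show "E \<in> inv_dreams n z \<Longrightarrow> finite E"
    unfolding inv_dreams_def using finite_subset[of E "{1..n} \<times> {1..n}"] by auto
qed

lemma le_ID_ladder: "le_ID = ladder\<^sup>*\<^sup>*"
proof -
  have "(\<lambda>D E. ladder_PD D E \<or> ladder_ID D E) = ladder" by (simp add: ladder_def fun_eq_iff)
  then show ?thesis unfolding le_ID_def less_ID_def by (simp add: reflclp_tranclp)
qed

lemma D_hat_bot_least:
  assumes z: "z \<in> involutions n" and E: "E \<in> inv_dreams n z"
  shows "ladder\<^sup>*\<^sup>* (D_hat_bot n z) E"
  using E
proof (induction "sum snd E" arbitrary: E rule: less_induct)
  case less
  show ?case
  proof (cases "\<exists>D. ladder D E")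
    case True
    then obtain D where D: "ladder D E" by blast
    have "D \<in> inv_dreams n z" using inv_dreams_ladder_back[OF less.prems D] .
    then have "ladder\<^sup>*\<^sup>* (D_hat_bot n z) D"
      using less.hyps ladder_sum_less[OF D] finite_inv_dream by blast
    then show ?thesis using D by (rule rtranclp.rtrancl_into_rtrancl)
  next
    case False
    then show ?thesis using minimal_inv_dream[OF z less.prems] by auto
  qed
qed

text \<open>A dream of least column sum has no incoming move, because the source would be a dream of
  smaller sum. As the only dream without incoming moves is the bottom element, the latter has this
  property.\<close>

lemma D_hat_bot_minimal:
  assumes z: "z \<in> involutions n"
  shows "\<not> ladder D (D_hat_bot n z)"
proof
  assume l: "ladder D (D_hat_bot n z)"
  let ?B = "D_hat_bot n z"
  obtain E where E: "E \<in> inv_dreams n z"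
    and least: "\<And>E'. E' \<in> inv_dreams n z \<Longrightarrow> sum snd E \<le> sum snd E'"
    using ex_has_least_nat[of "\<lambda>E. E \<in> inv_dreams n z" ?B "sum snd"] D_hat_bot_inv_dream[OF z]
    by blast
  have "\<not> ladder D' E" for D'
  proof
    assume l': "ladder D' E"
    then have "D' \<in> inv_dreams n z" using inv_dreams_ladder_back[OF E] by blast
    then show False using least[of D'] ladder_sum_less[OF l'] finite_inv_dream[of D'] by fastforce
  qed
  moreover have "E = ?B" using minimal_inv_dream[OF z E] calculation by blast
  ultimately show False using l by blast
qed

lemma inv_dreams_up_closed:
  assumes "ladder\<^sup>*\<^sup>* D E" "D \<in> inv_dreams n z" "E \<subseteq> {(r, c). c \<le> r}"
  shows "E \<in> inv_dreams n z"
  using assms(1,3)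
proof (induction rule: rtranclp_induct)
  case base
  then show ?case using assms(2) by simp
next
  case (step X Y)
  have "X \<in> inv_dreams n z" by (rule step.IH[OF ladder_lower[OF step.hyps(2) step.prems]])
  then show ?case by (rule inv_dreams_ladder[OF _ step.hyps(2) step.prems])
qed

lemma inv_dreams_eq:
  assumes z: "z \<in> involutions n"
  shows "inv_dreams n z = {E. E \<subseteq> L n \<and> le_ID (D_hat_bot n z) E}"
    and "inv_dreams n z = {E. E \<subseteq> L n \<and> sim_ID (D_hat_bot n z) E}"
proof -
  have Ln: "L n \<subseteq> {(r, c). c \<le> r}" by (auto simp: L_def)
  have "E \<in> inv_dreams n z" if "E \<subseteq> L n" "le_ID (D_hat_bot n z) E" for E
    using inv_dreams_up_closed[OF _ D_hat_bot_inv_dream[OF z], of E] that Ln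
    by (auto simp only: le_ID_ladder)
  moreover have "E \<subseteq> L n" "le_ID (D_hat_bot n z) E" if "E \<in> inv_dreams n z" for E
    using that D_hat_bot_least[OF z that] by (auto simp only: le_ID_ladder inv_dreams_def)
  ultimately show eq: "inv_dreams n z = {E. E \<subseteq> L n \<and> le_ID (D_hat_bot n z) E}" by blast
  have "sim_ID (D_hat_bot n z) E \<longleftrightarrow> le_ID (D_hat_bot n z) E" for E
  proof -
    have "E = D_hat_bot n z" if "le_ID E (D_hat_bot n z)"
      using that unfolding le_ID_ladder
      by (cases rule: rtranclp.cases) (use D_hat_bot_minimal[OF z] in blast)+
    moreover have "le_ID (D_hat_bot n z) (D_hat_bot n z)" by (simp add: le_ID_ladder)
    ultimately show ?thesis by (auto simp: sim_ID_def symclp_def)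
  qed
  then show "inv_dreams n z = {E. E \<subseteq> L n \<and> sim_ID (D_hat_bot n z) E}" using eq by simp
qed

subsection \<open>Reduced words\<close>

primrec wprod :: "nat list \<Rightarrow> nat \<Rightarrow> nat" where
  "wprod [] = id"
| "wprod (k # ws) = adj k \<circ> wprod ws"

text \<open>Every letter must be an ascent of the product before it. \<open>run\<close> tests words
  in the same way, which allows a comparison letter by letter.\<close>

definition reduced_word :: "nat list \<Rightarrow> bool" where
  "reduced_word ws \<longleftrightarrow> (\<forall>u k v. ws = u @ k # v \<longrightarrow> wprod u k < wprod u (Suc k))"

lemma wprod_append [simp]: "wprod (u @ v) = wprod u \<circ> wprod v"
  by (induction u) auto

lemma wprod_rev [simp]: "wprod (rev w) (wprod w x) = x" "wprod w (wprod (rev w) x) = x"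
  by (induction w arbitrary: x) auto

lemma wprod_eq_iff [simp]: "wprod w x = wprod w y \<longleftrightarrow> x = y"
  by (metis wprod_rev(1))

lemma reduced_word_Nil [simp]: "reduced_word []"
  by (simp add: reduced_word_def)

lemma reduced_word_snoc:
  "reduced_word (ws @ [k]) \<longleftrightarrow> reduced_word ws \<and> wprod ws k < wprod ws (Suc k)"
proof
  assume r: "reduced_word (ws @ [k])"
  have "wprod u a < wprod u (Suc a)" if "ws = u @ a # v" for u a v
    using r that unfolding reduced_word_def by (metis append_Cons append_assoc)
  moreover have "wprod ws k < wprod ws (Suc k)" using r unfolding reduced_word_def by blast
  ultimately show "reduced_word ws \<and> wprod ws k < wprod ws (Suc k)"
    unfolding reduced_word_def by blast
next
  assume r: "reduced_word ws \<and> wprod ws k < wprod ws (Suc k)"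
  show "reduced_word (ws @ [k])"
    unfolding reduced_word_def
  proof (intro allI impI)
    fix u a v assume e: "ws @ [k] = u @ a # v"
    show "wprod u a < wprod u (Suc a)"
    proof (cases v rule: rev_cases)
      case Nil then show ?thesis using e r by auto
    next
      case (snoc v' b)
      then have "ws = u @ a # v'" using e by auto
      then show ?thesis using r unfolding reduced_word_def by blast
    qed
  qed
qed

text \<open>Needed because \<open>sym_cells\<close> grows at both ends. The conditions for
  \<open>k\<close> on the left and \<open>a\<close> on the right affect each other only if
  \<open>w\<close> carries \<open>{a, Suc a}\<close> onto \<open>{k, Suc k}\<close>, and then both
  sides are false.\<close>

lemma reduced_word_Cons:
  "reduced_word (k # w) \<longleftrightarrow> reduced_word w \<and> wprod (rev w) k < wprod (rev w) (Suc k)"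
proof (induction w rule: rev_induct)
  case Nil
  show ?case using reduced_word_snoc[of "[]" k] by simp
next
  case (snoc a w)
  let ?x = "wprod (rev w) k" and ?x' = "wprod (rev w) (Suc k)"
  have P: "wprod w ?x = k" "wprod w ?x' = Suc k" by simp_all
  have "?x < ?x' \<and> adj k (wprod w a) < adj k (wprod w (Suc a)) \<longleftrightarrow>
      wprod w a < wprod w (Suc a) \<and> adj a ?x < adj a ?x'"
  proof -
    consider "?x = a \<and> ?x' = Suc a" | "?x = Suc a \<and> ?x' = a"
      | "\<not> (?x = a \<and> ?x' = Suc a)" "\<not> (?x = Suc a \<and> ?x' = a)" by blast
    then show ?thesis
    proof cases
      case 1
      then have "wprod w a = k" "wprod w (Suc a) = Suc k" using P by auto
      then show ?thesis using 1 by simp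
    next
      case 2
      then have "wprod w a = Suc k" "wprod w (Suc a) = k" using P by auto
      then show ?thesis using 2 by simp
    next
      case 3
      have "\<not> (wprod w a = k \<and> wprod w (Suc a) = Suc k)" using 3(1) wprod_rev(1) by metis
      moreover have "\<not> (wprod w a = Suc k \<and> wprod w (Suc a) = k)" using 3(2) wprod_rev(1) by metis
      ultimately show ?thesis using 3 adj_less_iff by blast
    qed
  qed
  then show ?case
    using snoc.IH reduced_word_snoc[of "k # w" a] reduced_word_snoc[of w a] by auto
qed

lemma reduced_word_appendD: "reduced_word (u @ v) \<Longrightarrow> reduced_word u" "reduced_word (u @ v) \<Longrightarrow> reduced_word v"
proof -
  show "reduced_word (u @ v) \<Longrightarrow> reduced_word u"
    unfolding reduced_word_def by fastforce
  show "reduced_word (u @ v) \<Longrightarrow> reduced_word v"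
    by (induction u) (auto simp: reduced_word_Cons)
qed

text \<open>A reduced word exchanges two values only from increasing to decreasing order, so an
  inverted pair stays inverted and only its positions change.\<close>

lemma inversion_persists:
  "reduced_word (w @ v) \<Longrightarrow> x < y \<Longrightarrow> wprod w y < wprod w x \<Longrightarrow>
    \<exists>x' y'. x' < y' \<and> wprod (w @ v) x' = wprod w x \<and> wprod (w @ v) y' = wprod w y"
proof (induction v rule: rev_induct)
  case Nil
  then show ?case by auto
next
  case (snoc a v)
  have r: "reduced_word (w @ v)" "wprod (w @ v) a < wprod (w @ v) (Suc a)"
    using snoc.prems(1) reduced_word_snoc[of "w @ v" a] by auto
  obtain x' y' where xy: "x' < y'" "wprod (w @ v) x' = wprod w x" "wprod (w @ v) y' = wprod w y"
    using snoc r by blast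
  have "\<not> (x' = a \<and> y' = Suc a)" using r(2) xy snoc.prems(3) by auto
  then have "adj a x' < adj a y'" using xy(1) adj_less_iff[of x' a y'] by auto
  then show ?case using xy by (intro exI[of _ "adj a x'"] exI[of _ "adj a y'"]) auto
qed

lemma reduced_word_cross_once:
  assumes "reduced_word (u @ k # v @ k' # w)"
  shows "{wprod (u @ k # v) k', wprod (u @ k # v) (Suc k')} \<noteq> {wprod u k, wprod u (Suc k)}"
proof
  assume e: "{wprod (u @ k # v) k', wprod (u @ k # v) (Suc k')} = {wprod u k, wprod u (Suc k)}"
  let ?w = "u @ [k]"
  have k: "wprod u k < wprod u (Suc k)" using assms unfolding reduced_word_def by blast
  have r: "reduced_word ((?w @ v) @ [k'])" using assms reduced_word_appendD(1)[of "(?w @ v) @ [k']" w] by simp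
  then have k': "wprod (?w @ v) k' < wprod (?w @ v) (Suc k')" "reduced_word (?w @ v)"
    using reduced_word_snoc by blast+
  obtain x y where xy: "x < y" "wprod (?w @ v) x = wprod u (Suc k)" "wprod (?w @ v) y = wprod u k"
    using inversion_persists[OF k'(2), of k "Suc k"] k by auto
  have "wprod (?w @ v) k' = wprod u k \<and> wprod (?w @ v) (Suc k') = wprod u (Suc k)"
    using e k k'(1) by (auto simp: doubleton_eq_iff)
  then have "y = k'" "x = Suc k'" using xy(2,3) wprod_eq_iff by metis+
  then show False using xy(1) by simp
qed

text \<open>For the cells on and below the diagonal this lists the whole square in an order compatible with the
  direction of the pipes, and symmetrically around its middle.  Cells outside the staircase are
  harmless, since they never belong to a pipe dream.\<close>

definition sym_cells :: "pos list \<Rightarrow> pos list" where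
  "sym_cells cs = rev cs @ map prod.swap (filter (\<lambda>c. fst c \<noteq> snd c) cs)"

definition cells_word :: "pos set \<Rightarrow> pos list \<Rightarrow> nat list" where
  "cells_word D cs = map letter (filter (\<lambda>c. c \<in> D) cs)"

lemma cells_word_simps [simp]:
  "cells_word D [] = []"
  "cells_word D (c # cs) = (if c \<in> D then letter c # cells_word D cs else cells_word D cs)"
  "cells_word D (cs @ cs') = cells_word D cs @ cells_word D cs'"
  by (simp_all add: cells_word_def)

section \<open>Sweep order of the cells and tracing of pipes\<close>

definition southwest :: "pos \<Rightarrow> pos \<Rightarrow> bool" where
  "southwest c' c \<longleftrightarrow> fst c \<le> fst c' \<and> snd c' \<le> snd c"

lemma set_lower_cells: "set (lower_cells n) = L n"
proof (induction n)
  case 0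
  show ?case by (auto simp: L_def)
next
  case (Suc n)
  have "L (Suc n) = L n \<union> Pair (Suc n) ` {1..Suc n}"
    by (auto simp: L_def image_iff le_Suc_eq)
  then show ?case using Suc by (simp add: atLeastLessThanSuc_atLeastAtMost del: upt_Suc)
qed

lemma sorted_lower_cells:
  "sorted_wrt (\<lambda>c c'. fst c < fst c' \<or> fst c = fst c' \<and> snd c' < snd c) (lower_cells n)"
proof (induction n)
  case (Suc n)
  have "sorted_wrt (\<lambda>c c'. fst c < fst c' \<or> fst c = fst c' \<and> snd c' < snd c)
      (map (Pair (Suc n)) (rev [1..<Suc (Suc n)]))"
    unfolding sorted_wrt_map sorted_wrt_rev by (simp del: upt_Suc)
  then show ?case using Suc by (auto simp: sorted_wrt_append set_lower_cells L_def simp del: upt_Suc)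
qed simp

text \<open>Pipes enter a cell from the left and from below, so everything southwest of a cell has
  to be swept before it.\<close>

lemma sorted_full_cells: "sorted_wrt (\<lambda>c c'. \<not> southwest c' c) (sym_cells (lower_cells n))"
  unfolding sym_cells_def sorted_wrt_append
proof (intro conjI ballI)
  show "sorted_wrt (\<lambda>c c'. \<not> southwest c' c) (rev (lower_cells n))"
    unfolding sorted_wrt_rev
    by (rule sorted_wrt_mono_rel[OF _ sorted_lower_cells]) (auto simp: southwest_def)
  show "sorted_wrt (\<lambda>c c'. \<not> southwest c' c) (map prod.swap (filter (\<lambda>c. fst c \<noteq> snd c) (lower_cells n)))"
    unfolding sorted_wrt_map
    by (rule sorted_wrt_mono_rel[OF _ sorted_wrt_filter[OF sorted_lower_cells]]) (auto simp: southwest_def)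
qed (auto simp: southwest_def set_lower_cells L_def)

lemma set_full_cells: "set (sym_cells (lower_cells n)) = {1..n} \<times> {1..n}"
proof
  show "set (sym_cells (lower_cells n)) \<subseteq> {1..n} \<times> {1..n}"
    by (auto simp: sym_cells_def set_lower_cells L_def)
  show "{1..n} \<times> {1..n} \<subseteq> set (sym_cells (lower_cells n))"
  proof
    fix c assume "c \<in> {1..n} \<times> {1..n}"
    then obtain i j where c: "c = (i, j)" "i \<in> {1..n}" "j \<in> {1..n}" by blast
    show "c \<in> set (sym_cells (lower_cells n))"
    proof (cases "j \<le> i")
      case True then show ?thesis using c by (simp add: sym_cells_def set_lower_cells L_def)
    next
      case False
      then have "(j, i) \<in> set (filter (\<lambda>c. fst c \<noteq> snd c) (lower_cells n))"
        using c by (simp add: set_lower_cells L_def)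
      then have "prod.swap (j, i) \<in> prod.swap ` set (filter (\<lambda>c. fst c \<noteq> snd c) (lower_cells n))"
        by (rule imageI)
      then show ?thesis using c by (simp add: sym_cells_def)
    qed
  qed
qed

text \<open>An edge ends at most one segment, so pipes are identified by looking one segment
  back.\<close>

lemma pipe_through_last:
  "pipe_through n D p e \<longleftrightarrow> p \<in> {1..n} \<and> (e = LeftOf p 1 \<or> (\<exists>e'. pipe_through n D p e' \<and> segment n D e' e))"
proof -
  have "(segment n D)\<^sup>*\<^sup>* (LeftOf p 1) e \<longleftrightarrow>
      e = LeftOf p 1 \<or> (\<exists>e'. (segment n D)\<^sup>*\<^sup>* (LeftOf p 1) e' \<and> segment n D e' e)"
    by (metis rtranclp.cases rtranclp.rtrancl_refl rtranclp.rtrancl_into_rtrancl)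
  then show ?thesis by (simp only: pipe_through_def) blast
qed

lemma pipe_through_Left1: "pipe_through n D p (LeftOf i (Suc 0)) \<longleftrightarrow> p \<in> {1..n} \<and> p = i"
proof -
  have "\<not> segment n D e (LeftOf i (Suc 0))" for e
    by (rule notI, erule segment.cases) (auto simp: staircase_def)
  then show ?thesis by (subst pipe_through_last) auto
qed

lemma pipe_through_Left:
  assumes "(i, j) \<in> staircase n"
  shows "pipe_through n D p (LeftOf i (Suc j)) \<longleftrightarrow>
    (if (i, j) \<in> D then pipe_through n D p (LeftOf i j) else pipe_through n D p (TopOf (Suc i) j))"
proof -
  have "j \<noteq> 0" using assms by (auto simp: staircase_def)
  moreover have "segment n D e (LeftOf i (Suc j)) \<longleftrightarrow> e = (if (i, j) \<in> D then LeftOf i j else TopOf (Suc i) j)" for e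
    using assms by (auto elim!: segment.cases intro: segment.intros[of i j n D, simplified])
  ultimately show ?thesis
    by (subst pipe_through_last) (auto simp: pipe_through_def)
qed

lemma pipe_through_Top:
  assumes "(i, j) \<in> staircase n"
  shows "pipe_through n D p (TopOf i j) \<longleftrightarrow>
    (if (i, j) \<in> D then pipe_through n D p (TopOf (Suc i) j) else pipe_through n D p (LeftOf i j))"
proof -
  have "segment n D e (TopOf i j) \<longleftrightarrow> e = (if (i, j) \<in> D then TopOf (Suc i) j else LeftOf i j)" for e
    using assms by (auto elim!: segment.cases intro: segment.intros[of i j n D, simplified] simp: staircase_def)
  then show ?thesis
    by (subst pipe_through_last) (auto simp: pipe_through_def)
qed

lemma pipe_through_Top_boundary:
  assumes "i \<in> {1..n}" "j \<in> {1..n}" "i + j = Suc n"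
  shows "pipe_through n D p (TopOf i j) \<longleftrightarrow> pipe_through n D p (LeftOf i j)"
proof -
  have "segment n D e (TopOf i j) \<longleftrightarrow> e = LeftOf i j" for e
    using assms by (auto elim!: segment.cases intro: segment.boundary simp: staircase_def)
  then show ?thesis
    by (subst pipe_through_last) (auto simp: pipe_through_def)
qed

subsection \<open>Pipes as a moving front\<close>

definition southwest_closed :: "nat \<Rightarrow> pos set \<Rightarrow> bool" where
  "southwest_closed n u \<longleftrightarrow> (\<forall>i j i' j'. (i, j) \<in> u \<longrightarrow> i \<le> i' \<longrightarrow> i' \<le> n \<longrightarrow> 1 \<le> j' \<longrightarrow> j' \<le> j \<longrightarrow> (i', j') \<in> u)"

text \<open>\<open>LeftOf i j\<close> and \<open>TopOf i j\<close> both lie on line \<open>i + j - 1\<close>.  Once the cells in \<open>u\<close> have been passed,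
  \<open>s\<close> maps each line to the pipe on it.\<close>

definition front :: "nat \<Rightarrow> pos set \<Rightarrow> pos set \<Rightarrow> (nat \<Rightarrow> nat) \<Rightarrow> bool" where
  "front n D u s \<longleftrightarrow>
    (\<forall>i j p. 1 \<le> i \<longrightarrow> i + j \<le> n \<longrightarrow> (i, Suc j) \<notin> u \<longrightarrow> (j = 0 \<or> (i, j) \<in> u) \<longrightarrow>
       (pipe_through n D p (LeftOf i (Suc j)) \<longleftrightarrow> p = s (i + j))) \<and>
    (\<forall>i j p. 1 \<le> j \<longrightarrow> i + j \<le> n \<longrightarrow> (i, j) \<notin> u \<longrightarrow> (Suc i, j) \<in> u \<longrightarrow>
       (pipe_through n D p (TopOf (Suc i) j) \<longleftrightarrow> p = s (i + j)))"

lemma frontD: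
  assumes "front n D u s"
  shows "1 \<le> i \<Longrightarrow> i + j \<le> n \<Longrightarrow> (i, Suc j) \<notin> u \<Longrightarrow> j = 0 \<or> (i, j) \<in> u \<Longrightarrow>
       pipe_through n D p (LeftOf i (Suc j)) \<longleftrightarrow> p = s (i + j)"
    and "1 \<le> j \<Longrightarrow> i + j \<le> n \<Longrightarrow> (i, j) \<notin> u \<Longrightarrow> (Suc i, j) \<in> u \<Longrightarrow>
       pipe_through n D p (TopOf (Suc i) j) \<longleftrightarrow> p = s (i + j)"
  by (rule conjunct1[OF assms[unfolded front_def], rule_format]; assumption)
    (rule conjunct2[OF assms[unfolded front_def], rule_format]; assumption)

text \<open>Avoiding paths run from left to top and from bottom to right and keep their lines;
  crossing paths exchange the lines \<open>a + b\<close> and \<open>Suc (a + b)\<close>. Because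
  \<open>u\<close> is closed towards the southwest, no other edge of the new front lies on these two
  lines.\<close>

lemma front_step:
  assumes f: "front n D u s" and cl: "southwest_closed n u" and D: "D \<subseteq> staircase n"
    and a: "1 \<le> a" "a \<le> n" and b: "Suc b \<le> n" and nu: "(a, Suc b) \<notin> u"
    and lp: "b = 0 \<or> (a, b) \<in> u" and bp: "a = n \<or> (Suc a, Suc b) \<in> u"
  shows "front n D (insert (a, Suc b) u) (if (a, Suc b) \<in> D then s \<circ> adj (a + b) else s)"
proof -
  let ?c = "(a, Suc b)" and ?k = "a + b"
  let ?s = "if ?c \<in> D then s \<circ> adj ?k else s"
  have dc: "(i', j') \<in> u" if "(i, j) \<in> u" "i \<le> i'" "i' \<le> n" "1 \<le> j'" "j' \<le> j" for i j i' j'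
    using cl that unfolding southwest_closed_def by blast
  have cD: "a + b < n" if "?c \<in> D" using D that by (auto simp: staircase_def)
  have new: "?s x = s x" if "x \<noteq> ?k" "x \<noteq> Suc ?k" for x
    using that by (simp add: adj_other)
  have left: "pipe_through n D p (LeftOf a (Suc b)) \<longleftrightarrow> p = s ?k" if "a + b \<le> n" for p
    using frontD(1)[OF f a(1) that nu lp] .
  have bot: "pipe_through n D p (TopOf (Suc a) (Suc b)) \<longleftrightarrow> p = s (Suc ?k)" if "a + b < n" for p
    using frontD(2)[OF f, of "Suc b" a p] nu bp b that by auto
  show ?thesis
    unfolding front_def
  proof (intro conjI allI impI)
    fix i j p
    assume i: "1 \<le> i" "i + j \<le> n" and n': "(i, Suc j) \<notin> insert ?c u" and p': "j = 0 \<or> (i, j) \<in> insert ?c u"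
    show "pipe_through n D p (LeftOf i (Suc j)) \<longleftrightarrow> p = ?s (i + j)"
    proof (cases "(i, j) = ?c")
      case True
      then have st: "?c \<in> staircase n" using i a b by (auto simp: staircase_def)
      then have "a + b < n" by (auto simp: staircase_def)
      then show ?thesis using True pipe_through_Left[OF st, of D p] left bot by auto
    next
      case False
      then have p'': "j = 0 \<or> (i, j) \<in> u" using p' by blast
      have "i + j \<noteq> ?k \<and> i + j \<noteq> Suc ?k"
      proof (intro conjI notI)
        assume e: "i + j = ?k"
        consider "i = a" | "i > a" | "i < a" by linarith
        then show False
        proof cases
          case 1 then show False using e n' by simp
        next
          case 2
          then have "b \<noteq> 0" using e by simp
          then have "(i, Suc j) \<in> u" using dc[of a b i "Suc j"] lp 2 e i by auto
          then show False using n' by simp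
        next
          case 3
          then have "?c \<in> u" using dc[of i j a "Suc b"] p'' e a by auto
          then show False using nu by simp
        qed
      next
        assume e: "i + j = Suc ?k"
        show False
        proof (cases "i > a")
          case True
          then have "(i, Suc j) \<in> u" using dc[of "Suc a" "Suc b" i "Suc j"] bp e i by auto
          then show False using n' by simp
        next
          case False
          then have "?c \<in> u" using dc[of i j a "Suc b"] p'' e a by auto
          then show False using nu by simp
        qed
      qed
      then show ?thesis using frontD(1)[OF f i _ p''] n' new by simp
    qed
  next
    fix i j p
    assume j: "1 \<le> j" "i + j \<le> n" and n': "(i, j) \<notin> insert ?c u" and p': "(Suc i, j) \<in> insert ?c u"
    show "pipe_through n D p (TopOf (Suc i) j) \<longleftrightarrow> p = ?s (i + j)"
    proof (cases "(Suc i, j) = ?c")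
      case True
      then have ij: "Suc i = a" "j = Suc b" and e: "i + j = ?k" by auto
      show ?thesis
      proof (cases "a + b = n")
        case True
        then have "?c \<notin> D" using cD by auto
        moreover have "pipe_through n D p (TopOf a (Suc b)) \<longleftrightarrow> pipe_through n D p (LeftOf a (Suc b))"
          by (rule pipe_through_Top_boundary) (use a b True in auto)
        ultimately show ?thesis using left[of p] True unfolding e unfolding ij by simp
      next
        case False
        then have lt: "a + b < n" using j ij by simp
        then have "?c \<in> staircase n" using a b by (simp add: staircase_def)
        then show ?thesis using pipe_through_Top[of a "Suc b" n D p] left[of p] bot[of p] lt
          unfolding e unfolding ij by simp
      qed
    next
      case False
      then have p'': "(Suc i, j) \<in> u" using p' by blast
      have "i + j \<noteq> ?k \<and> i + j \<noteq> Suc ?k"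
      proof (intro conjI notI)
        assume e: "i + j = ?k"
        show False
        proof (cases "i < a")
          case True
          then have "?c \<in> u" using dc[of "Suc i" j a "Suc b"] p'' e a by auto
          then show False using nu by simp
        next
          case False
          then have "b \<noteq> 0" using e j by simp
          then have "(i, j) \<in> u" using dc[of a b i j] lp False e j by auto
          then show False using n' by simp
        qed
      next
        assume e: "i + j = Suc ?k"
        consider "i = a" | "i > a" | "i < a" by linarith
        then show False
        proof cases
          case 1 then show False using e n' by simp
        next
          case 2
          then have "b \<noteq> 0" using e j by simp
          then have "(i, j) \<in> u" using dc[of a b i j] lp 2 e j by auto
          then show False using n' by simp
        next
          case 3
          then have "?c \<in> u" using dc[of "Suc i" j a "Suc b"] p'' e a by auto
          then show False using nu by simp
        qed
      qed
      then show ?thesis using frontD(2)[OF f j _ p''] n' new by simp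
    qed
  qed
qed

lemma full_cells_split:
  assumes "sym_cells (lower_cells n) = cs @ (i, j) # cs'"
  shows "i \<in> {1..n}" "j \<in> {1..n}" "(i, j) \<notin> set cs" "southwest_closed n (set cs)"
    "\<And>i' j'. i \<le> i' \<Longrightarrow> i' \<le> n \<Longrightarrow> 1 \<le> j' \<Longrightarrow> j' \<le> j \<Longrightarrow> (i', j') \<noteq> (i, j) \<Longrightarrow> (i', j') \<in> set cs"
proof -
  have st: "set (sym_cells (lower_cells n)) = {1..n} \<times> {1..n}" by (rule set_full_cells)
  have "(i, j) \<in> {1..n} \<times> {1..n}" unfolding st[symmetric] assms by simp
  then show ij: "i \<in> {1..n}" "j \<in> {1..n}" by simp_all
  have so: "sorted_wrt (\<lambda>c c'. \<not> southwest c' c) (cs @ (i, j) # cs')"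
    using sorted_full_cells[of n] unfolding assms .
  then have A: "\<not> southwest c' c" if "c \<in> set cs" "c' = (i, j) \<or> c' \<in> set cs'" for c c'
    using that by (auto simp: sorted_wrt_append)
  have B: "\<not> southwest c' (i, j)" if "c' \<in> set cs'" for c' using so that by (auto simp: sorted_wrt_append)
  show "(i, j) \<notin> set cs" using A by (fastforce simp: southwest_def)
  show "southwest_closed n (set cs)"
    unfolding southwest_closed_def
  proof (intro allI impI)
    fix a b a' b' assume h: "(a, b) \<in> set cs" "a \<le> a'" "a' \<le> n" "1 \<le> b'" "b' \<le> b"
    have "(a, b) \<in> {1..n} \<times> {1..n}" unfolding st[symmetric] assms using h(1) by simp
    then have "(a', b') \<in> {1..n} \<times> {1..n}" using h by auto
    then have "(a', b') \<in> set (cs @ (i, j) # cs')" using st unfolding assms by blast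
    moreover have "southwest (a', b') (a, b)" using h by (simp add: southwest_def)
    ultimately show "(a', b') \<in> set cs" using A[OF h(1)] by auto
  qed
  fix i' j' assume h: "i \<le> i'" "i' \<le> n" "1 \<le> j'" "j' \<le> j" "(i', j') \<noteq> (i, j)"
  then have "(i', j') \<in> {1..n} \<times> {1..n}" using ij by auto
  then have "(i', j') \<in> set (cs @ (i, j) # cs')" using st unfolding assms by blast
  moreover have "southwest (i', j') (i, j)" using h by (simp add: southwest_def)
  ultimately show "(i', j') \<in> set cs" using B h(5) by auto
qed

lemma front_cells:
  assumes D: "D \<subseteq> staircase n"
  shows "sym_cells (lower_cells n) = cs @ cs' \<Longrightarrow> front n D (set cs) (wprod (cells_word D cs))"
proof (induction cs arbitrary: cs' rule: rev_induct)
  case Nil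
  show ?case by (auto simp: front_def pipe_through_Left1)
next
  case (snoc c cs)
  obtain i j where c: "c = (i, j)" by (cases c)
  have e: "sym_cells (lower_cells n) = cs @ (i, j) # cs'" using snoc.prems c by simp
  note s = full_cells_split[OF e]
  obtain b where b: "j = Suc b" using s(2) by (cases j) auto
  have "front n D (insert (i, Suc b) (set cs))
      (if (i, Suc b) \<in> D then wprod (cells_word D cs) \<circ> adj (i + b) else wprod (cells_word D cs))"
  proof (rule front_step[OF snoc.IH[OF e] s(4) D])
    show "b = 0 \<or> (i, b) \<in> set cs" using s(5)[of i b] s(1) b by (cases "b = 0") auto
    show "i = n \<or> (Suc i, Suc b) \<in> set cs" using s(5)[of "Suc i" "Suc b"] s(1,2) b by (cases "i = n") auto
  qed (use s b in auto)
  moreover have "wprod (cells_word D (cs @ [c])) =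
      (if (i, Suc b) \<in> D then wprod (cells_word D cs) \<circ> adj (i + b) else wprod (cells_word D cs))"
    by (simp add: c b)
  ultimately show ?case by (simp add: c b)
qed

text \<open>Turns crossing and avoiding into equations between prefix products.\<close>

lemma meet_at_cells:
  assumes D: "D \<subseteq> staircase n" and e: "sym_cells (lower_cells n) = cs @ c # cs'" and c: "c \<in> staircase n"
    and s: "s = wprod (cells_word D cs)"
  shows "meet_at n D p q c \<longleftrightarrow> p = s (letter c) \<and> q = s (Suc (letter c)) \<or>
    q = s (letter c) \<and> p = s (Suc (letter c))"
proof -
  obtain i j where ij: "c = (i, j)" by (cases c)
  obtain b where b: "j = Suc b" using c ij by (cases j) (auto simp: staircase_def)
  have lt: "i + j \<le> n" "1 \<le> i" using c by (auto simp: staircase_def ij)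
  note sp = full_cells_split[OF e[unfolded ij]]
  have f: "front n D (set cs) s" using front_cells[OF D e] s by simp
  have "b = 0 \<or> (i, b) \<in> set cs" using sp(5)[of i b] sp(1) b by (cases "b = 0") auto
  then have "pipe_through n D p (LeftOf i j) \<longleftrightarrow> p = s (i + b)" for p
    using frontD(1)[OF f, of i b p] sp(3) lt b by simp
  moreover have "pipe_through n D p (TopOf (Suc i) j) \<longleftrightarrow> p = s (i + j)" for p
    using frontD(2)[OF f, of j i p] sp(3) sp(5)[of "Suc i" j] lt b by auto
  ultimately show ?thesis by (simp add: ij b meet_at_def)
qed

text \<open>The full product leads from top to left endpoints, so it is the inverse of the
  permutation drawn by \<open>D\<close>. In \<open>PD_iff\<close> the two coincide because
  \<open>z\<close> is an involution.\<close>

lemma pipe_through_top_edge: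
  assumes D: "D \<subseteq> staircase n" and j: "j \<in> {1..n}"
  shows "pipe_through n D p (TopOf 1 j) \<longleftrightarrow> p = wprod (cells_word D (sym_cells (lower_cells n))) j"
proof -
  have f: "front n D (set (sym_cells (lower_cells n))) (wprod (cells_word D (sym_cells (lower_cells n))))"
    using front_cells[OF D, of "sym_cells (lower_cells n)" "[]"] by simp
  show ?thesis using frontD(2)[OF f, of j 0 p] j unfolding set_full_cells by auto
qed

section \<open>Reduced pipe dreams as reduced words\<close>

lemma staircase_full: "c \<in> staircase n \<Longrightarrow> c \<in> set (sym_cells (lower_cells n))"
  unfolding set_full_cells by (auto simp: staircase_def)

lemma reduced_pipe_dream_iff:
  "reduced_pipe_dream n D \<longleftrightarrow>
    D \<subseteq> staircase n \<and> reduced_word (cells_word D (sym_cells (lower_cells n)))"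
proof (intro iffI conjI)
  assume "reduced_pipe_dream n D"
  then show "D \<subseteq> staircase n" by (simp add: reduced_pipe_dream_def)
next
  let ?F = "sym_cells (lower_cells n)"
  assume r: "reduced_pipe_dream n D"
  have D: "D \<subseteq> staircase n"
    and once: "\<And>p q c c'. p \<in> {1..n} \<Longrightarrow> q \<in> {1..n} \<Longrightarrow> p \<noteq> q \<Longrightarrow> cross_at n D p q c \<Longrightarrow> cross_at n D p q c' \<Longrightarrow> c = c'"
    using r unfolding reduced_pipe_dream_def by blast+
  have range: "p \<in> {1..n} \<and> q \<in> {1..n}" if "cross_at n D p q c" for p q c
    using that by (cases c) (auto simp: cross_at_def meet_at_def pipe_through_def)
  \<comment> \<open>The induction carries a witness: every inversion of the prefix product comes
    from an earlier crossing of the two pipes. A letter that is not an ascent would then be their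
    second crossing.\<close>
  have "reduced_word (cells_word D cs) \<and>
    (\<forall>x y. x < y \<longrightarrow> wprod (cells_word D cs) y < wprod (cells_word D cs) x \<longrightarrow>
      (\<exists>c\<in>set cs. cross_at n D (wprod (cells_word D cs) x) (wprod (cells_word D cs) y) c))"
    if "?F = cs @ cs'" for cs cs'
    using that
  proof (induction cs arbitrary: cs' rule: rev_induct)
    case Nil
    show ?case by simp
  next
    case (snoc c cs)
    have e: "?F = cs @ c # cs'" using snoc.prems by simp
    have IH: "reduced_word (cells_word D cs)"
      "\<And>x y. x < y \<Longrightarrow> wprod (cells_word D cs) y < wprod (cells_word D cs) x \<Longrightarrow>
      (\<exists>c\<in>set cs. cross_at n D (wprod (cells_word D cs) x) (wprod (cells_word D cs) y) c)"
      using snoc.IH[OF e] by auto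
    show ?case
    proof (cases "c \<in> D")
      case False
      then show ?thesis using IH by simp
    next
      case True
      define s k where "s = wprod (cells_word D cs)" and "k = letter c"
      have cs: "c \<in> staircase n" using True D by blast
      have cr: "cross_at n D (s k) (s (Suc k)) c" "cross_at n D (s (Suc k)) (s k) c"
        using meet_at_cells[OF D e cs s_def] True cs by (auto simp: cross_at_def k_def)
      have "c \<notin> set cs" using full_cells_split(3)[of n cs "fst c" "snd c" cs'] e by simp
      have lt: "s k < s (Suc k)"
      proof (rule ccontr)
        assume "\<not> s k < s (Suc k)"
        moreover have "s k \<noteq> s (Suc k)" by (simp add: s_def)
        ultimately have "s (Suc k) < s k" by simp
        then obtain c0 where "c0 \<in> set cs" "cross_at n D (s k) (s (Suc k)) c0"
          using IH(2)[of k "Suc k"] by (auto simp: s_def)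
        then show False using once[OF _ _ _ cr(1)] range[OF cr(1)] \<open>s k \<noteq> s (Suc k)\<close> \<open>c \<notin> set cs\<close> by blast
      qed
      have w: "cells_word D (cs @ [c]) = cells_word D cs @ [k]" using True by (simp add: k_def)
      have P: "wprod (cells_word D (cs @ [c])) = s \<circ> adj k" unfolding w s_def by simp
      have "\<exists>d\<in>set (cs @ [c]). cross_at n D (s (adj k x)) (s (adj k y)) d"
        if "x < y" "s (adj k y) < s (adj k x)" for x y
      proof (cases "x = k \<and> y = Suc k")
        case True
        then show ?thesis using cr(2) by auto
      next
        case False
        then have "adj k x < adj k y" using adj_less_iff[of x k y] that(1) by auto
        then show ?thesis using IH(2)[of "adj k x" "adj k y"] that(2) by (auto simp: s_def)
      qed
      then show ?thesis unfolding P using IH(1) lt reduced_word_snoc[of "cells_word D cs" k]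
        unfolding w s_def by auto
    qed
  qed
  from this[of ?F "[]"] show "reduced_word (cells_word D ?F)" by simp
next
  let ?F = "sym_cells (lower_cells n)"
  assume h: "D \<subseteq> staircase n \<and> reduced_word (cells_word D ?F)"
  then have D: "D \<subseteq> staircase n" by simp
  have later: False if e: "?F = u @ c # v @ c' # w" and cc: "cross_at n D p q c" "cross_at n D p q c'" for p q c c' u v w
  proof -
    have c: "c \<in> staircase n" "c \<in> D" "c' \<in> staircase n" "c' \<in> D" using cc by (auto simp: cross_at_def)
    let ?u = "cells_word D u" and ?v = "cells_word D v" and ?w = "cells_word D w"
    have W: "cells_word D ?F = ?u @ letter c # ?v @ letter c' # ?w"
      unfolding e using c by simp
    have e': "?F = (u @ c # v) @ c' # w" using e by simp
    have 1: "{p, q} = {wprod ?u (letter c), wprod ?u (Suc (letter c))}"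
      using meet_at_cells[OF D e c(1) refl, of p q] cc(1) by (auto simp: cross_at_def)
    have 2: "{p, q} = {wprod (?u @ letter c # ?v) (letter c'), wprod (?u @ letter c # ?v) (Suc (letter c'))}"
      using meet_at_cells[OF D e' c(3) refl, of p q] cc(2) c(2) by (auto simp: cross_at_def)
    show False using reduced_word_cross_once[of ?u "letter c" ?v "letter c'" ?w] h W 1 2 by metis
  qed
  have "c = c'" if cc: "cross_at n D p q c" "cross_at n D p q c'" for p q c c'
  proof (rule ccontr)
    assume ne: "c \<noteq> c'"
    have "c \<in> set ?F" "c' \<in> set ?F" using cc staircase_full by (auto simp: cross_at_def)
    then obtain u v where uv: "?F = u @ c # v" by (meson split_list)
    then consider "c' \<in> set u" | "c' \<in> set v" using \<open>c' \<in> set ?F\<close> ne by auto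
    then show False
    proof cases
      case 1
      then obtain u1 u2 where "u = u1 @ c' # u2" by (meson split_list)
      then show False using later[of u1 c' u2 c v p q] uv cc by simp
    next
      case 2
      then obtain v1 v2 where "v = v1 @ c' # v2" by (meson split_list)
      then show False using later[of u c v1 c' v2 p q] uv cc by simp
    qed
  qed
  then show "reduced_pipe_dream n D" using D unfolding reduced_pipe_dream_def by blast
qed

lemma PD_iff:
  assumes z: "z \<in> involutions n"
  shows "D \<in> PD n z \<longleftrightarrow> D \<subseteq> staircase n \<and>
    reduced_word (cells_word D (sym_cells (lower_cells n))) \<and>
    wprod (cells_word D (sym_cells (lower_cells n))) = z"
proof (cases "D \<subseteq> staircase n")
  case True
  let ?w = "cells_word D (sym_cells (lower_cells n))"
  note zz = involutionsD(2)[OF z] and zn = involutionsD(3)[OF z]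
  have small: "1 \<le> k \<and> k < n" if "k \<in> set ?w" for k
    using that True by (fastforce simp: cells_word_def staircase_def)
  have fix0: "wprod w x = x" if "\<And>k. k \<in> set w \<Longrightarrow> 1 \<le> k \<and> k < n" "x \<notin> {1..n}" for w x
    using that(1)
  proof (induction w)
    case (Cons k w)
    then have "wprod w x = x" by simp
    moreover have "1 \<le> k" "k < n" using Cons.prems by simp_all
    ultimately show ?case using that(2) by (auto simp: adj_if)
  qed simp
  have "(\<forall>i\<in>{1..n}. pipe_through n D i (TopOf 1 (z i))) \<longleftrightarrow> (\<forall>i\<in>{1..n}. wprod ?w (z i) = i)"
    using pipe_through_top_edge[OF True] zn by (metis (no_types))
  also have "\<dots> \<longleftrightarrow> wprod ?w = z"
  proof
    assume h: "\<forall>i\<in>{1..n}. wprod ?w (z i) = i"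
    show "wprod ?w = z"
    proof
      fix x
      show "wprod ?w x = z x"
      proof (cases "x \<in> {1..n}")
        case True then show ?thesis using h zz zn by metis
      next
        case False
        then show ?thesis using fix0[of ?w x] small involutionsD(1)[OF z] by (simp add: permutes_def)
      qed
    qed
  qed (use zz in simp)
  finally show ?thesis using True by (auto simp: PD_def reduced_pipe_dream_iff)
qed (auto simp: PD_def reduced_pipe_dream_def)

subsection \<open>Almost-symmetric pipe dreams\<close>

lemma sym_cells_snoc:
  "sym_cells (cs @ [c]) = c # sym_cells cs @ (if fst c \<noteq> snd c then [prod.swap c] else [])"
  by (simp add: sym_cells_def)

lemma sym_cells_append:
  "sym_cells (cs @ rest) = rev rest @ sym_cells cs @ map prod.swap (filter (\<lambda>c. fst c \<noteq> snd c) rest)"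
  by (simp add: sym_cells_def)

lemma letter_swap [simp]: "letter (prod.swap c) = letter c"
  by (cases c) (simp add: add.commute)

lemma lower_cells_split:
  assumes "lower_cells n = cs @ c # rest" "x \<in> set cs"
  shows "fst x < fst c \<or> fst x = fst c \<and> snd c < snd x"
  using sorted_lower_cells[of n] assms by (auto simp: sorted_wrt_append)

lemma takeWhile_before:
  assumes "lower_cells n = cs @ c # rest"
  shows "takeWhile (\<lambda>x. x \<noteq> c) (lower_cells n) = cs"
proof -
  have "x \<noteq> c" if "x \<in> set cs" for x using lower_cells_split[OF assms that] by auto
  then have "takeWhile (\<lambda>x. x \<noteq> c) (cs @ c # rest) = cs @ takeWhile (\<lambda>x. x \<noteq> c) (c # rest)"
    by (intro takeWhile_append2)
  then show ?thesis using assms by simp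
qed

text \<open>Cells before \<open>(j, j)\<close> have letters at most \<open>2 * j - 3\<close>. A
  diagonal crossing therefore always falls under the fixed-point case of \<open>iconj\<close>, in
  accordance with its having no separate mirror image.\<close>

lemma run_fixes_diagonal:
  assumes e: "lower_cells n = cs @ (j, j) # rest"
    and r: "run (cells_word D cs) id = Some y"
  shows "y (2 * j - 1) = 2 * j - 1" "y (Suc (2 * j - 1)) = Suc (2 * j - 1)"
proof -
  have w: "Suc w < 2 * j - 1" if "w \<in> set (cells_word D cs)" for w
  proof -
    obtain a b where ab: "(a, b) \<in> set cs" "w = a + b - 1" using \<open>w \<in> _\<close> by (auto simp: cells_word_def)
    have "(a, b) \<in> set (lower_cells n)" using ab e by simp
    then have "(a, b) \<in> L n" by (simp only: set_lower_cells)
    then have "b \<le> a" "1 \<le> b" by (auto simp: L_def)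
    moreover have "a < j" using lower_cells_split[OF e ab(1)] calculation by auto
    ultimately show ?thesis using ab(2) by linarith
  qed
  show "y (2 * j - 1) = 2 * j - 1" by (rule run_fix[OF r]) (use w in fastforce)+
  show "y (Suc (2 * j - 1)) = Suc (2 * j - 1)" by (rule run_fix[OF r]) (use w in fastforce)+
qed

lemma adj_commute_fixed:
  assumes "invol y" "y k = k" "y (Suc k) = Suc k"
  shows "adj k \<circ> y = y \<circ> adj k"
proof
  fix v
  have "y v \<noteq> k \<and> y v \<noteq> Suc k" if "v \<noteq> k" "v \<noteq> Suc k" using assms that invol_inj by metis
  then show "(adj k \<circ> y) v = (y \<circ> adj k) v" using assms by (auto simp: adj_if)
qed

text \<open>Decides whether the mirror letter may be appended: with \<open>k\<close> already on the
  left, \<open>k\<close> on the right is an ascent precisely in the conjugation case of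
  \<open>iconj\<close>.\<close>

lemma adj_ascent_iff:
  assumes "invol y" "y k < y (Suc k)"
  shows "adj k (y k) < adj k (y (Suc k)) \<longleftrightarrow> \<not> (y k = k \<and> y (Suc k) = Suc k)"
  using adj_less_iff[of "y k" k "y (Suc k)"] assms(2) by auto

lemma wprod_rev_invol: "invol (wprod w) \<Longrightarrow> wprod (rev w) = wprod w"
  by (rule ext) (metis invol_def wprod_rev(2) wprod_eq_iff)

lemma wprod_invol_of_run: "run ws id = Some (wprod w) \<Longrightarrow> invol (wprod w)"
  using invol_run invol_id by blast

lemma PD_to_inv_dreams:
  assumes z: "z \<in> involutions n" and PD: "D \<in> PD n z" and as: "almost_symmetric n D"
  shows "D \<inter> L n \<in> inv_dreams n z"
proof -
  let ?F = "sym_cells (lower_cells n)"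
  have D: "D \<subseteq> staircase n" and red: "reduced_word (cells_word D ?F)" and pz: "wprod (cells_word D ?F) = z"
    using PD PD_iff[OF z] by auto
  have as1: "(j, i) \<in> D" if "i < j" "(i, j) \<in> D" for i j
    using as that unfolding almost_symmetric_def by blast
  have as2: "cross_at n D p q (j, i) \<longleftrightarrow> avoid_at n D p q (i, j)"
    if "i < j" "(j, i) \<in> D" "(i, j) \<notin> D" for i j p q
    using as that unfolding almost_symmetric_def by blast
  \<comment> \<open>The involution read so far is the product over the central block
    \<open>sym_cells cs\<close>. A further cell extends the block on the left, and its mirror image
    extends it on the right.\<close>
  have "run (cells_word D cs) id = Some (wprod (cells_word D (sym_cells cs)))"
    if "lower_cells n = cs @ rest" for cs rest
    using that
  proof (induction cs arbitrary: rest rule: rev_induct)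
    case Nil
    show ?case by (simp add: sym_cells_def)
  next
    case (snoc c cs)
    obtain j i where c: "c = (j, i)" by (cases c)
    define k where "k = letter c"
    let ?W = "cells_word D (sym_cells cs)"
    let ?off = "map prod.swap (filter (\<lambda>c. fst c \<noteq> snd c) rest)"
    have e: "lower_cells n = cs @ (j, i) # rest" using snoc.prems c by simp
    have IH: "run (cells_word D cs) id = Some (wprod ?W)" using snoc.IH[OF e[folded c]] .
    have iv: "invol (wprod ?W)" using wprod_invol_of_run[OF IH] .
    have "(j, i) \<in> L n" using e set_lower_cells[of n] by auto
    then have ij: "i \<le> j" by (simp add: L_def)
    have F: "?F = rev rest @ sym_cells (cs @ [c]) @ ?off"
      using sym_cells_append[of "cs @ [c]" rest] snoc.prems by simp
    have red': "reduced_word (cells_word D (sym_cells (cs @ [c])))"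
      using red unfolding F cells_word_simps by (blast dest: reduced_word_appendD)
    show ?case
    proof (cases "c \<in> D")
      case False
      then have "fst c \<noteq> snd c \<Longrightarrow> prod.swap c \<notin> D" using as1[of i j] c ij by auto
      then have "cells_word D (sym_cells (cs @ [c])) = ?W" using False by (simp add: sym_cells_snoc)
      moreover have "cells_word D (cs @ [c]) = cells_word D cs" using False by simp
      ultimately show ?thesis using IH by (simp only:)
    next
      case True
      have "reduced_word (k # ?W)"
        using red' True reduced_word_appendD(1)[of "k # ?W"] by (auto simp: sym_cells_snoc k_def split: if_splits)
      then have asc: "wprod ?W k < wprod ?W (Suc k)"
        using reduced_word_Cons wprod_rev_invol[OF iv] by metis
      have "cells_word D (cs @ [c]) = cells_word D cs @ [k]" using True by (simp add: k_def)
      then have step: "run (cells_word D (cs @ [c])) id = Some (iconj k (wprod ?W))"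
        using asc by (simp add: run_append IH)
      have fixed: ?thesis
        if f: "wprod ?W k = k" "wprod ?W (Suc k) = Suc k" and n: "fst c \<noteq> snd c \<Longrightarrow> prod.swap c \<notin> D"
      proof -
        have "iconj k (wprod ?W) = adj k \<circ> wprod ?W"
          using f adj_commute_fixed[OF iv f] by (simp add: iconj_def)
        moreover have "cells_word D (sym_cells (cs @ [c])) = k # ?W"
          using True n by (simp add: sym_cells_snoc k_def)
        ultimately show ?thesis unfolding step by (simp only: wprod.simps)
      qed
      consider "i = j" | "i < j" "(i, j) \<in> D" | "i < j" "(i, j) \<notin> D" using ij by linarith
      then show ?thesis
      proof cases
        case 1
        then have "k = 2 * j - 1" by (simp add: k_def c mult_2)
        then show ?thesis using fixed run_fixes_diagonal[of n cs j rest D "wprod ?W"] e 1 IH c by simp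
      next
        case 2
        then have "cells_word D (sym_cells (cs @ [c])) = (k # ?W) @ [k]"
          using True by (simp add: sym_cells_snoc c k_def add.commute)
        then have "reduced_word ((k # ?W) @ [k])" and P: "wprod (cells_word D (sym_cells (cs @ [c]))) = adj k \<circ> wprod ?W \<circ> adj k"
          using red' by (auto simp: comp_assoc)
        then have "adj k (wprod ?W k) < adj k (wprod ?W (Suc k))"
          by (simp only: reduced_word_snoc wprod.simps comp_apply)
        then have "\<not> (wprod ?W k = k \<and> wprod ?W (Suc k) = Suc k)" using adj_ascent_iff[OF iv asc] by blast
        then have "iconj k (wprod ?W) = adj k \<circ> wprod ?W \<circ> adj k" by (simp only: iconj_def if_False)
        then show ?thesis unfolding step P by (simp only:)
      next
        case 3
        \<comment> \<open>\<open>U\<close> is the front on arrival at \<open>(j, i)\<close>.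
          Almost-symmetry puts the same two pipes on lines \<open>k\<close> and \<open>Suc k\<close>
          at \<open>(i, j)\<close>; cancelling \<open>U\<close> shows that \<open>wprod ?W\<close>
          preserves \<open>{k, Suc k}\<close>, and the ascent excludes an exchange.\<close>
        define U where "U = wprod (cells_word D (rev rest))"
        have e1: "?F = rev rest @ (j, i) # (sym_cells cs @ prod.swap c # ?off)"
          using F 3 by (simp add: sym_cells_snoc c)
        have e2: "?F = (rev rest @ (j, i) # sym_cells cs) @ (i, j) # ?off"
          using F 3 by (simp add: sym_cells_snoc c)
        have st: "(j, i) \<in> staircase n" using True D c by blast
        then have st': "(i, j) \<in> staircase n" by (auto simp: staircase_def)
        have k': "letter (j, i) = k" "letter (i, j) = k" by (simp_all add: k_def c add.commute)
        have "cross_at n D (U k) (U (Suc k)) (j, i)"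
          using meet_at_cells[OF D e1 st U_def, of "U k" "U (Suc k)"] st True c k' by (simp add: cross_at_def)
        then have m: "meet_at n D (U k) (U (Suc k)) (i, j)" using as2[OF 3(1) _ 3(2)] True c by (simp add: avoid_at_def)
        have v: "U \<circ> adj k \<circ> wprod ?W = wprod (cells_word D (rev rest @ (j, i) # sym_cells cs))"
          using True c k' by (simp add: U_def comp_assoc)
        have "U k = U (adj k (wprod ?W k)) \<and> U (Suc k) = U (adj k (wprod ?W (Suc k))) \<or>
            U (Suc k) = U (adj k (wprod ?W k)) \<and> U k = U (adj k (wprod ?W (Suc k)))"
          using m unfolding meet_at_cells[OF D e2 st' refl] v[symmetric] k' comp_apply .
        then have "k = adj k (wprod ?W k) \<and> Suc k = adj k (wprod ?W (Suc k)) \<or>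
            Suc k = adj k (wprod ?W k) \<and> k = adj k (wprod ?W (Suc k))"
          by (simp only: U_def wprod_eq_iff)
        then have "wprod ?W k = Suc k \<and> wprod ?W (Suc k) = k \<or> wprod ?W k = k \<and> wprod ?W (Suc k) = Suc k"
          by (metis adj_adj adj_apply)
        then have f: "wprod ?W k = k" "wprod ?W (Suc k) = Suc k" using asc by auto
        show ?thesis by (rule fixed[OF f]) (use 3 c in simp)
      qed
    qed
  qed
  from this[of "lower_cells n" "[]"] have "run (cells_word D (lower_cells n)) id = Some z" using pz by simp
  moreover have "cells_word D (lower_cells n) = word n (D \<inter> L n)"
    unfolding cells_word_def word_def
    by (intro arg_cong[of _ _ "map letter"] filter_cong) (auto simp: set_lower_cells)
  ultimately show ?thesis using D by (auto simp: inv_dreams_def)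
qed

lemma inv_dreams_to_PD:
  assumes z: "z \<in> involutions n" and E: "E \<in> inv_dreams n z"
  obtains D where "D \<in> PD n z" "almost_symmetric n D" "D \<inter> L n = E"
proof -
  let ?F = "sym_cells (lower_cells n)"
  have EL: "E \<subseteq> L n" and ES: "E \<subseteq> staircase n" and rE: "run (word n E) id = Some z"
    using E by (auto simp: inv_dreams_def)
  \<comment> \<open>The prefix before a cell of \<open>lower_cells n\<close> runs successfully, so
    \<open>the\<close> meets no \<open>None\<close> at these cells.\<close>
  define before where
    "before c = the (run (cells_word E (takeWhile (\<lambda>x. x \<noteq> c) (lower_cells n))) id)" for c
  define fixing where
    "fixing c \<longleftrightarrow> before c (letter c) = letter c \<and> before c (Suc (letter c)) = Suc (letter c)" for c
  \<comment> \<open>A mirror image is added exactly for the letters that act by conjugation.\<close>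
  define D where "D = E \<union> {(i, j). i < j \<and> (j, i) \<in> E \<and> \<not> fixing (j, i)}"
  have Elow: "i \<le> j" if "(j, i) \<in> E" for i j using EL that by (auto simp: L_def)
  have DS: "D \<subseteq> staircase n" using ES by (auto simp: D_def staircase_def)
  have Dlow: "(j, i) \<in> D \<longleftrightarrow> (j, i) \<in> E" if "i \<le> j" for i j using that by (auto simp: D_def)
  have Dup: "(i, j) \<in> D \<longleftrightarrow> (j, i) \<in> E \<and> \<not> fixing (j, i)" if "i < j" for i j
    using that Elow[of i j] by (auto simp: D_def)
  have DL: "D \<inter> L n = E" using EL by (auto simp: D_def L_def)
  have main: "run (cells_word E cs) id = Some (wprod (cells_word D (sym_cells cs))) \<and>
      reduced_word (cells_word D (sym_cells cs))"
    if "lower_cells n = cs @ rest" for cs rest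
    using that
  proof (induction cs arbitrary: rest rule: rev_induct)
    case Nil
    show ?case by (simp add: sym_cells_def)
  next
    case (snoc c cs)
    obtain j i where c: "c = (j, i)" by (cases c)
    define k where "k = letter c"
    let ?W = "cells_word D (sym_cells cs)"
    have e: "lower_cells n = cs @ (j, i) # rest" using snoc.prems c by simp
    have IH: "run (cells_word E cs) id = Some (wprod ?W)" "reduced_word ?W"
      using snoc.IH[OF e[folded c]] by blast+
    have iv: "invol (wprod ?W)" using wprod_invol_of_run[OF IH(1)] .
    have "(j, i) \<in> L n" using e set_lower_cells[of n] by auto
    then have ij: "i \<le> j" by (simp add: L_def)
    have "takeWhile (\<lambda>x. x \<noteq> c) (lower_cells n) = cs"
      using takeWhile_before[OF e] c by simp
    then have bc: "before c = wprod ?W" using IH(1) by (simp add: before_def)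
    show ?case
    proof (cases "c \<in> E")
      case False
      then have "c \<notin> D" "fst c \<noteq> snd c \<Longrightarrow> prod.swap c \<notin> D"
        using Dlow[OF ij] Dup[of i j] c ij by auto
      then have "cells_word D (sym_cells (cs @ [c])) = ?W" by (simp add: sym_cells_snoc)
      moreover have "cells_word E (cs @ [c]) = cells_word E cs" using False by simp
      ultimately show ?thesis using IH by (simp only:)
    next
      case True
      then have cD: "c \<in> D" using Dlow[OF ij] c by simp
      have "word n E = cells_word E (cs @ [c]) @ cells_word E rest"
        using snoc.prems by (simp add: word_def cells_word_def)
      then have asc: "wprod ?W k < wprod ?W (Suc k)"
        using rE IH(1) True by (auto simp: run_append k_def[symmetric] split: if_splits)
      have "cells_word E (cs @ [c]) = cells_word E cs @ [k]" using True by (simp add: k_def)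
      then have step: "run (cells_word E (cs @ [c])) id = Some (iconj k (wprod ?W))"
        using asc by (simp add: run_append IH)
      have rk: "reduced_word (k # ?W)"
        using reduced_word_Cons[of k ?W] IH(2) asc wprod_rev_invol[OF iv] by simp
      show ?thesis
      proof (cases "i < j \<and> \<not> fixing c")
        case t: True
        then have w: "cells_word D (sym_cells (cs @ [c])) = (k # ?W) @ [k]"
          using cD True Dup[of i j] by (simp add: sym_cells_snoc c k_def add.commute)
        have nf: "\<not> (wprod ?W k = k \<and> wprod ?W (Suc k) = Suc k)" using t by (simp add: fixing_def bc k_def)
        then have "reduced_word ((k # ?W) @ [k])"
          unfolding reduced_word_snoc using rk adj_ascent_iff[OF iv asc] by simp
        moreover have "iconj k (wprod ?W) = wprod ((k # ?W) @ [k])"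
          using nf unfolding iconj_def by (auto simp: comp_assoc)
        ultimately show ?thesis unfolding w step by (simp only: simp_thms)
      next
        case f: False
        have w: "cells_word D (sym_cells (cs @ [c])) = k # ?W"
          using cD f Dup[of i j] ij by (auto simp: sym_cells_snoc c k_def)
        have "wprod ?W k = k \<and> wprod ?W (Suc k) = Suc k"
        proof (cases "i = j")
          case t: True
          then have "k = 2 * j - 1" by (simp add: k_def c mult_2)
          then show ?thesis using run_fixes_diagonal[of n cs j rest E "wprod ?W"] e t IH(1) by simp
        next
          case False
          then show ?thesis using f ij by (simp add: fixing_def bc k_def)
        qed
        then have "iconj k (wprod ?W) = wprod (k # ?W)"
          using adj_commute_fixed[OF iv] by (simp add: iconj_def)
        then show ?thesis using rk unfolding w step by (simp only: simp_thms)
      qed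
    qed
  qed
  have "cells_word E (lower_cells n) = word n E" by (simp add: cells_word_def word_def)
  then have full: "wprod (cells_word D ?F) = z" "reduced_word (cells_word D ?F)"
    using main[of "lower_cells n" "[]"] rE by simp_all
  have PD: "D \<in> PD n z" using PD_iff[OF z] DS full by blast
  have "cross_at n D p q (j, i) \<longleftrightarrow> avoid_at n D p q (i, j)"
    if h: "i < j" "(j, i) \<in> D" "(i, j) \<notin> D" for i j p q
  proof -
    have jE: "(j, i) \<in> E" using Dlow[of i j] h by simp
    have "fixing (j, i)" using Dup[OF h(1)] h jE by blast
    have "(j, i) \<in> set (lower_cells n)" using jE EL by (auto simp: set_lower_cells)
    then obtain cs rest where e: "lower_cells n = cs @ (j, i) # rest" by (meson split_list)
    let ?W = "cells_word D (sym_cells cs)"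
    let ?off = "map prod.swap (filter (\<lambda>c. fst c \<noteq> snd c) rest)"
    define k where "k = letter (j, i)"
    have k': "letter (j, i) = k" "letter (i, j) = k" by (simp_all add: k_def add.commute)
    have "takeWhile (\<lambda>x. x \<noteq> (j, i)) (lower_cells n) = cs"
      by (rule takeWhile_before[OF e])
    then have "before (j, i) = wprod ?W" using main[OF e] by (simp add: before_def)
    then have f: "wprod ?W k = k" "wprod ?W (Suc k) = Suc k" using \<open>fixing (j, i)\<close> by (simp_all add: fixing_def k_def)
    define U where "U = wprod (cells_word D (rev rest))"
    have F: "?F = rev rest @ sym_cells (cs @ [(j, i)]) @ ?off"
      using sym_cells_append[of "cs @ [(j, i)]" rest] e by simp
    have e1: "?F = rev rest @ (j, i) # (sym_cells cs @ (i, j) # ?off)"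
      using F h by (simp add: sym_cells_snoc)
    have e2: "?F = (rev rest @ (j, i) # sym_cells cs) @ (i, j) # ?off"
      using F h by (simp add: sym_cells_snoc)
    have st: "(j, i) \<in> staircase n" using h DS by blast
    then have st': "(i, j) \<in> staircase n" by (auto simp: staircase_def)
    have "wprod (cells_word D (rev rest @ (j, i) # sym_cells cs)) = U \<circ> adj k \<circ> wprod ?W"
      using h k' by (simp add: U_def comp_assoc)
    \<comment> \<open>As \<open>wprod ?W\<close> fixes \<open>k\<close> and \<open>Suc k\<close>,
      the pipes crossing at \<open>(j, i)\<close> return on the same two lines with exchanged roles,
      a difference that \<open>meet_at\<close> ignores.\<close>
    then have "meet_at n D p q (i, j) \<longleftrightarrow> meet_at n D p q (j, i)"
      using meet_at_cells[OF DS e1 st U_def, of p q] meet_at_cells[OF DS e2 st' refl, of p q] k' f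
      by auto
    then show ?thesis using st st' h by (simp add: cross_at_def avoid_at_def)
  qed
  moreover have "(j, i) \<in> D" if "i < j" "(i, j) \<in> D" for i j
    using that Dup[OF that(1)] Dlow[of i j] by simp
  ultimately have "almost_symmetric n D"
    unfolding almost_symmetric_def reduced_pipe_dream_iff using DS full(2)
    by (intro conjI allI impI) auto
  then show ?thesis by (rule that[OF PD _ DL])
qed

lemma ID_eq_inv_dreams:
  assumes z: "z \<in> involutions n"
  shows "ID n z = inv_dreams n z"
proof (intro set_eqI iffI)
  fix E assume "E \<in> ID n z"
  then obtain D where "E = D \<inter> L n" "D \<in> PD n z" "almost_symmetric n D"
    unfolding ID_def by (elim CollectE exE conjE) (rule that)
  then show "E \<in> inv_dreams n z" using PD_to_inv_dreams[OF z] by simp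
next
  fix E assume "E \<in> inv_dreams n z"
  then obtain D where "D \<in> PD n z" "almost_symmetric n D" "D \<inter> L n = E"
    by (rule inv_dreams_to_PD[OF z])
  then show "E \<in> ID n z" unfolding ID_def by (intro CollectI exI[of _ D] conjI) simp_all
qed

theorem theorem5p8:
  fixes n :: nat and z :: "nat \<Rightarrow> nat"
  assumes "n \<ge> 1" and "z \<in> involutions n"
  shows "ID n z = {E. E \<subseteq> L n \<and> le_ID (D_hat_bot n z) E} \<and>
    {E. E \<subseteq> L n \<and> le_ID (D_hat_bot n z) E} = {E. E \<subseteq> L n \<and> sim_ID (D_hat_bot n z) E}"
  using ID_eq_inv_dreams[OF assms(2)] inv_dreams_eq[OF assms(2)] by simp

end
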